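(* For the finite-horizon linear system with linear Gaussian policy, its REINFORCE estimators $\widehat G_K,\widehat G_\ell$, and the lifted matrices described in the context, $$\mathrm{Var}_{\mathrm{Fro}}(\widehat G_K)\le2\underbrace{\mathbb E\big[\|\overline\Sigma^{-1}\bar\varepsilon\|_2^2\,\|\mathcal F_Ss_0\|_2^2\,R(\tau)^2\big]}_{(\star)}+2\underbrace{\mathbb E\big[\|\overline\Sigma^{-1}\bar\varepsilon\|_2^2\,\|\mathcal F_E\bar\varepsilon\|_2^2\,R(\tau)^2\big]}_{(\dagger)},$$ $$\mathrm{Var}_{\mathrm{Fro}}(\widehat G_\ell)\le T\,\mathbb E\big[(2\|\overline\Sigma^{-1/2}\bar\varepsilon\|_2^4+2mT)\,R(\tau)^2\big],$$ and the expectations on the right-hand sides admit the following explicit Gaussian-moment expansions. With $S:=\mathcal F_S^\top\mathcal F_S$, $E:=\mathcal F_E^\top\mathcal F_E$, $U:=\overline M_{se}\overline M_{se}^\top$, $V:=\overline M_{se}\overline\Sigma\,\overline M_{se}^\top$, $X(s_0):=\overline M_{se}^\top s_0s_0^\top\overline M_{se}$ and $d:=mT$: $$\begin{aligned}(\star)={}&\mathrm{IS}_{\overline\Sigma}(\overline\Sigma^{-2})\,\mathrm{IS}_{\Sigma_0}(S,\overline M_{ss},\overline M_{ss})+\mathrm{IS}_{\Sigma_0}(S)\,\mathrm{IS}_{\overline\Sigma}(\overline\Sigma^{-2},\overline M_{ee},\overline M_{ee})\\&+2\,\mathrm{IS}_{\Sigma_0}(S,\overline M_{ss})\,\mathrm{IS}_{\overline\Sigma}(\overline\Sigma^{-2},\overline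 M_{ee})+4\big(\mathrm{IS}_{\overline\Sigma}(\overline\Sigma^{-2})\,\mathrm{IS}_{\Sigma_0}(S,V)+2\,\mathrm{IS}_{\Sigma_0}(S,U)\big),\end{aligned}$$ $$\begin{aligned}(\dagger)={}&\mathrm{IS}_{\overline\Sigma}(\overline\Sigma^{-2},E)\,\mathrm{IS}_{\Sigma_0}(\overline M_{ss},\overline M_{ss})+\mathrm{IS}_{\overline\Sigma}(\overline\Sigma^{-2},E,\overline M_{ee},\overline M_{ee})\\&+2\,\mathrm{IS}_{\Sigma_0}(\overline M_{ss})\,\mathrm{IS}_{\overline\Sigma}(\overline\Sigma^{-2},E,\overline M_{ee})+4\,\mathbb E_{s_0}\big[\mathrm{IS}_{\overline\Sigma}(\overline\Sigma^{-2},E,X(s_0))\big],\end{aligned}$$ $$\begin{aligned}T\,\mathbb E\big[(2\|\overline\Sigma^{-1/2}\bar\varepsilon\|_2^4+2mT)R(\tau)^2\big]={}&T\Big(2\big[\mathrm{IS}_{\Sigma_0}(\overline M_{ss},\overline M_{ss})\,\mathrm{IS}_{\overline\Sigma}(\overline\Sigma^{-1},\overline\Sigma^{-1})+\mathrm{IS}_{\overline\Sigma}(\overline\Sigma^{-1},\overline\Sigma^{-1},\overline M_{ee},\overline M_{ee})\\&\quad+2\,\mathrm{IS}_{\Sigma_0}(\overline M_{ss})\,\mathrm{IS}_{\overline\Sigma}(\overline\Sigma^{-1},\overline\Sigma^{-1},\overline M_{ee})+4(d+2)(d+4)\,\mathrm{IS}_{\Sigma_0}(V)\big]\\&+2mT\big[\mathrm{IS}_{\Sigma_0}(\overline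 M_{ss},\overline M_{ss})+\mathrm{IS}_{\overline\Sigma}(\overline M_{ee},\overline M_{ee})+2\,\mathrm{IS}_{\Sigma_0}(\overline M_{ss})\,\mathrm{IS}_{\overline\Sigma}(\overline M_{ee})+4\,\mathrm{IS}_{\Sigma_0}(V)\big]\Big).\end{aligned}$$
   Context: **System.** $n,m,T\ge1$, $A\in\mathbb R^{n\times n}$, $B\in\mathbb R^{n\times m}$, $K\in\mathbb R^{m\times n}$, $F:=A+BK$; $Q_s\in\mathbb R^{n\times n}$, $Q_a\in\mathbb R^{m\times m}$ symmetric positive semidefinite; $\gamma\in(0,1]$ the discount factor; $\Sigma=\mathrm{diag}(e^{2\ell_1},\dots,e^{2\ell_m})\succ0$ with $\ell\in\mathbb R^m$; $\Sigma_0\succeq0$. $s_0\sim\mathcal N(0,\Sigma_0)$ and $\varepsilon_0,\dots,\varepsilon_{T-1}\sim\mathcal N(0,\Sigma)$ are independent; $a_t=Ks_t+\varepsilon_t$, $s_{t+1}=As_t+Ba_t=Fs_t+B\varepsilon_t$. Reward $r(s,a)=-(s^\top Q_ss+a^\top Q_aa)$, return $R(\tau)=\sum_{t=0}^{T-1}\gamma^tr(s_{t+1},a_t)$. REINFORCE estimators: $$\widehat G_K=\sum_{t=0}^{T-1}\Sigma^{-1}\varepsilon_ts_t^\top R(\tau),\qquad \widehat G_\ell=\sum_{t=0}^{T-1}\big(\Sigma^{-1}(\varepsilon_t\odot\varepsilon_t)-\mathbf 1\big)R(\tau),$$ with $\odot$ the Hadamard product and $\mathbf 1$ the all-ones vector.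 $\mathrm{Var}_{\mathrm{Fro}}(\widehat G):=\mathbb E[\|\widehat G-\mathbb E\widehat G\|_{\mathrm F}^2]$. **Lifted matrices.** Let $\bar\varepsilon=(\varepsilon_0^\top,\dots,\varepsilon_{T-1}^\top)^\top\in\mathbb R^{mT}$, $\overline\Sigma:=I_T\otimes\Sigma$. For $t=0,\dots,T$ let $F_t:=F^t$, and let $E_t\in\mathbb R^{n\times mT}$ be the block row whose block in position $i\in\{0,\dots,T-1\}$ is $F^{t-1-i}B$ if $i\le t-1$ and $0$ otherwise, so that $s_t=F_ts_0+E_t\bar\varepsilon$. Let $\Pi_t\in\mathbb R^{m\times mT}$ be the block selector with $\varepsilon_t=\Pi_t\bar\varepsilon$. Let $\mathcal F_S,\mathcal F_E$ be the vertical stacks of $F_0,\dots,F_{T-1}$ and of $E_0,\dots,E_{T-1}$; $\mathcal F_S^+,\mathcal F_E^+$ the vertical stacks of $F_1,\dots,F_T$ and of $E_1,\dots,E_T$; $\mathcal K_S,\mathcal K_E$ the vertical stacks of $KF_0,\dots,KF_{T-1}$ and of $KE_0+\Pi_0,\dots,KE_{T-1}+\Pi_{T-1}$. With $D_\gamma=\mathrm{diag}(\gamma^0,\dots,\gamma^{T-1})$, $\mathsf Q_{s,\gamma}=D_\gamma\otimes Q_s$, $\mathsf Q_{a,\gamma}=D_\gamma\otimes Q_a$, set $$\overline M_{ss}={\mathcal F_S^+}^\top\mathsf Q_{s,\gamma}\mathcal F_S^++\mathcal K_S^\top\mathsf Q_{a,\gamma}\mathcal K_S,\quad \overline M_{se}={\mathcal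 F_S^+}^\top\mathsf Q_{s,\gamma}\mathcal F_E^++\mathcal K_S^\top\mathsf Q_{a,\gamma}\mathcal K_E,\quad \overline M_{ee}={\mathcal F_E^+}^\top\mathsf Q_{s,\gamma}\mathcal F_E^++\mathcal K_E^\top\mathsf Q_{a,\gamma}\mathcal K_E.$$ Then $R(\tau)=-(s_0^\top\overline M_{ss}s_0+2s_0^\top\overline M_{se}\bar\varepsilon+\bar\varepsilon^\top\overline M_{ee}\bar\varepsilon)$. **Shorthand.** For $\Omega\succeq0$, $x\sim\mathcal N(0,\Omega)$ and symmetric real $A_1,\dots,A_k$: $\mathrm{IS}_\Omega(A_1,\dots,A_k):=\mathbb E[\prod_{i=1}^kx^\top A_ix]$. $\mathbb E_{s_0}$ is expectation over $s_0\sim\mathcal N(0,\Sigma_0)$. *)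

theory Defs
  imports "HOL-Probability.Probability"
begin

text \<open>
  Vectors and matrices are those of HOL-Analysis. Three conventions of that library matter here.
  On vectors, \<open>*\<close> and \<open>1\<close> are the componentwise product and the all-ones vector. On matrices,
  \<open>^\<close> is also componentwise, hence the separate \<open>mat_pow\<close>. The norm of a matrix is its
  Frobenius norm.
\<close>

primrec mat_pow :: "real^'n^'n \<Rightarrow> nat \<Rightarrow> real^'n^'n" where
  "mat_pow F 0 = mat 1"
| "mat_pow F (Suc k) = F ** mat_pow F k"

definition diag :: "real^'n \<Rightarrow> real^'n^'n" where
  "diag v = (\<chi> i j. if i = j then v $ i else 0)"

definition outer :: "real^'a \<Rightarrow> real^'b \<Rightarrow> real^'b^'a" where
  "outer x y = (\<chi> i j. x $ i * y $ j)"

definition psd :: "real^'n^'n \<Rightarrow> bool" where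
  "psd Q \<longleftrightarrow> transpose Q = Q \<and> (\<forall>x. 0 \<le> x \<bullet> (Q *v x))"

text \<open>The principal square root of a positive semidefinite matrix.\<close>

definition psd_sqrt :: "real^'n^'n \<Rightarrow> real^'n^'n" where
  "psd_sqrt Q = (THE L. psd L \<and> L ** L = Q)"

definition kron :: "real^'b^'a \<Rightarrow> real^'d^'c \<Rightarrow> real^('b \<times> 'd)^('a \<times> 'c)" where
  "kron X Y = (\<chi> p q. X $ fst p $ fst q * Y $ snd p $ snd q)"

text \<open>
  \<open>mv_normal Q\<close> is the law of \<open>psd_sqrt Q *v z\<close>, where the components of \<open>z\<close> are independent
  standard normal variables; \<open>Q\<close> may be singular.
\<close>

definition mv_normal :: "real^'n^'n \<Rightarrow> (real^'n) measure" where
  "mv_normal Q =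
     distr (\<Pi>\<^sub>M i\<in>(UNIV :: 'n set). density lborel std_normal_density) borel
       (\<lambda>z. psd_sqrt Q *v (\<chi> i. z i))"

definition IS :: "real^'n^'n \<Rightarrow> (real^'n^'n) list \<Rightarrow> real" where
  "IS Q As = (\<integral>x. (\<Prod>A\<leftarrow>As. x \<bullet> (A *v x)) \<partial>mv_normal Q)"

definition Var_Fro :: "'w measure \<Rightarrow> ('w \<Rightarrow> 'v::euclidean_space) \<Rightarrow> real" where
  "Var_Fro M G = (\<integral>\<omega>. (norm (G \<omega> - (\<integral>\<omega>'. G \<omega>' \<partial>M)))\<^sup>2 \<partial>M)"

text \<open>
  Mutual independence of the whole family consisting of \<open>X\<close> and all \<open>Y t\<close> with \<open>t \<in> I\<close>.
  The constant \<open>indep_vars\<close> does not apply directly, since the variables have different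
  value types; this is its unfolded definition, with \<open>None\<close> as the index of \<open>X\<close>.
\<close>

definition jointly_indep ::
    "'w measure \<Rightarrow> ('w \<Rightarrow> 'a::topological_space) \<Rightarrow> ('i \<Rightarrow> 'w \<Rightarrow> 'b::topological_space) \<Rightarrow> 'i set \<Rightarrow> bool" where
  "jointly_indep M X Y I \<longleftrightarrow>
     X \<in> borel_measurable M \<and> (\<forall>t\<in>I. Y t \<in> borel_measurable M) \<and>
     prob_space.indep_sets M
       (\<lambda>j. case j of
              None \<Rightarrow> {X -` Z \<inter> space M | Z. Z \<in> sets borel}
            | Some t \<Rightarrow> {Y t -` Z \<inter> space M | Z. Z \<in> sets borel})
       (insert None (Some ` I))"

text \<open>
  All functions below act on one realization: \<open>s0\<close> is the initial state and \<open>e t\<close> the policy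
  noise at time \<open>t\<close>.
\<close>

primrec state ::
    "real^'n^'n \<Rightarrow> real^'m^'n \<Rightarrow> real^'n^'m \<Rightarrow> real^'n \<Rightarrow> (nat \<Rightarrow> real^'m) \<Rightarrow> nat \<Rightarrow> real^'n" where
  "state A B K s0 e 0 = s0"
| "state A B K s0 e (Suc t) = A *v state A B K s0 e t + B *v (K *v state A B K s0 e t + e t)"

definition action ::
    "real^'n^'n \<Rightarrow> real^'m^'n \<Rightarrow> real^'n^'m \<Rightarrow> real^'n \<Rightarrow> (nat \<Rightarrow> real^'m) \<Rightarrow> nat \<Rightarrow> real^'m" where
  "action A B K s0 e t = K *v state A B K s0 e t + e t"

definition reward :: "real^'n^'n \<Rightarrow> real^'m^'m \<Rightarrow> real^'n \<Rightarrow> real^'m \<Rightarrow> real" where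
  "reward Qs Qa s a = - (s \<bullet> (Qs *v s) + a \<bullet> (Qa *v a))"

definition traj_return ::
    "real^'n^'n \<Rightarrow> real^'m^'n \<Rightarrow> real^'n^'m \<Rightarrow> real^'n^'n \<Rightarrow> real^'m^'m \<Rightarrow> real \<Rightarrow> nat
       \<Rightarrow> real^'n \<Rightarrow> (nat \<Rightarrow> real^'m) \<Rightarrow> real" where
  "traj_return A B K Qs Qa \<gamma> T s0 e =
     (\<Sum>t<T. \<gamma> ^ t * reward Qs Qa (state A B K s0 e (Suc t)) (action A B K s0 e t))"

definition reinforce_K ::
    "real^'n^'n \<Rightarrow> real^'m^'n \<Rightarrow> real^'n^'m \<Rightarrow> real^'n^'n \<Rightarrow> real^'m^'m \<Rightarrow> real \<Rightarrow> real^'m^'m \<Rightarrow> nat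
       \<Rightarrow> real^'n \<Rightarrow> (nat \<Rightarrow> real^'m) \<Rightarrow> real^'n^'m" where
  "reinforce_K A B K Qs Qa \<gamma> Sig T s0 e =
     (\<Sum>t<T. traj_return A B K Qs Qa \<gamma> T s0 e *\<^sub>R
        (matrix_inv Sig ** outer (e t) (state A B K s0 e t)))"

definition reinforce_l ::
    "real^'n^'n \<Rightarrow> real^'m^'n \<Rightarrow> real^'n^'m \<Rightarrow> real^'n^'n \<Rightarrow> real^'m^'m \<Rightarrow> real \<Rightarrow> real^'m^'m \<Rightarrow> nat
       \<Rightarrow> real^'n \<Rightarrow> (nat \<Rightarrow> real^'m) \<Rightarrow> real^'m" where
  "reinforce_l A B K Qs Qa \<gamma> Sig T s0 e =
     (\<Sum>t<T. traj_return A B K Qs Qa \<gamma> T s0 e *\<^sub>R (matrix_inv Sig *v (e t * e t) - 1))"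

text \<open>
  A horizon \<open>T \<ge> 1\<close> is represented by a finite linearly ordered type \<open>'t\<close> with \<open>T = CARD('t)\<close>.
  The map \<open>time\<close> is its order isomorphism onto \<open>{0..<T}\<close>. A vector made of \<open>T\<close> blocks of
  size \<open>m\<close> is indexed by \<open>'t \<times> 'm\<close>.
\<close>

definition time :: "'t::{finite,linorder} \<Rightarrow> nat" where
  "time t = card {..<t}"

lemma time_strict_mono: "strict_mono (time :: 't::{finite,linorder} \<Rightarrow> nat)"
proof (rule strict_monoI)
  fix x y :: 't assume "x < y"
  then have "{..<x} \<subset> {..<y}" by auto
  then show "time x < time y" by (auto simp: time_def intro: psubset_card_mono)
qed

lemma bij_betw_time: "bij_betw (time :: 't \<Rightarrow> nat) UNIV {..<CARD('t::{finite,linorder})}"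
proof -
  have inj: "inj (time :: 't \<Rightarrow> nat)"
    using time_strict_mono by (rule strict_mono_imp_inj_on)
  have "range (time :: 't \<Rightarrow> nat) \<subseteq> {..<CARD('t)}"
    by (auto simp: time_def intro!: psubset_card_mono)
  then have "range (time :: 't \<Rightarrow> nat) = {..<CARD('t)}"
    using inj by (intro card_subset_eq) (auto simp: card_image)
  then show ?thesis using inj by (simp add: bij_betw_def)
qed

definition vstack :: "('t::finite \<Rightarrow> real^'k^'r) \<Rightarrow> real^'k^('t \<times> 'r)" where
  "vstack Z = (\<chi> p. Z (fst p) $ snd p)"

definition lift_noise :: "(nat \<Rightarrow> real^'m) \<Rightarrow> real^('t::{finite,linorder} \<times> 'm)" where
  "lift_noise e = (\<chi> p. e (time (fst p)) $ snd p)"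

definition F_blk :: "real^'n^'n \<Rightarrow> real^'m^'n \<Rightarrow> real^'n^'m \<Rightarrow> nat \<Rightarrow> real^'n^'n" where
  "F_blk A B K t = mat_pow (A + B ** K) t"

definition E_blk ::
    "real^'n^'n \<Rightarrow> real^'m^'n \<Rightarrow> real^'n^'m \<Rightarrow> nat \<Rightarrow> real^('t::{finite,linorder} \<times> 'm)^'n" where
  "E_blk A B K t =
     (\<chi> k p. if time (fst p) < t
             then (mat_pow (A + B ** K) (t - 1 - time (fst p)) ** B) $ k $ snd p else 0)"

definition Pi_blk :: "nat \<Rightarrow> real^('t::{finite,linorder} \<times> 'm)^'m" where
  "Pi_blk t = (\<chi> j p. if time (fst p) = t \<and> snd p = j then 1 else 0)"

definition F_S :: "real^'n^'n \<Rightarrow> real^'m^'n \<Rightarrow> real^'n^'m \<Rightarrow> real^'n^('t::{finite,linorder} \<times> 'n)" where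
  "F_S A B K = vstack (\<lambda>t. F_blk A B K (time t))"

definition F_E ::
    "real^'n^'n \<Rightarrow> real^'m^'n \<Rightarrow> real^'n^'m \<Rightarrow> real^('t \<times> 'm)^('t::{finite,linorder} \<times> 'n)" where
  "F_E A B K = vstack (\<lambda>t. E_blk A B K (time t))"

definition F_S_plus ::
    "real^'n^'n \<Rightarrow> real^'m^'n \<Rightarrow> real^'n^'m \<Rightarrow> real^'n^('t::{finite,linorder} \<times> 'n)" where
  "F_S_plus A B K = vstack (\<lambda>t. F_blk A B K (Suc (time t)))"

definition F_E_plus ::
    "real^'n^'n \<Rightarrow> real^'m^'n \<Rightarrow> real^'n^'m \<Rightarrow> real^('t \<times> 'm)^('t::{finite,linorder} \<times> 'n)" where
  "F_E_plus A B K = vstack (\<lambda>t. E_blk A B K (Suc (time t)))"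

definition K_S :: "real^'n^'n \<Rightarrow> real^'m^'n \<Rightarrow> real^'n^'m \<Rightarrow> real^'n^('t::{finite,linorder} \<times> 'm)" where
  "K_S A B K = vstack (\<lambda>t. K ** F_blk A B K (time t))"

definition K_E ::
    "real^'n^'n \<Rightarrow> real^'m^'n \<Rightarrow> real^'n^'m \<Rightarrow> real^('t \<times> 'm)^('t::{finite,linorder} \<times> 'm)" where
  "K_E A B K = vstack (\<lambda>t. K ** E_blk A B K (time t) + Pi_blk (time t))"

definition discounted :: "real \<Rightarrow> real^'k^'k \<Rightarrow> real^('t \<times> 'k)^('t::{finite,linorder} \<times> 'k)" where
  "discounted \<gamma> Q = kron (diag (\<chi> t. \<gamma> ^ time t)) Q"

end

theory Submission
  imports Defs
begin

text \<open>
  The state is affine in \<open>(s0, \<epsilon>b)\<close>, so the return is minus a quadratic form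
  \<open>a(s0) + 2 b(s0, \<epsilon>b) + c(\<epsilon>b)\<close> with \<open>b\<close> bilinear. In the square of this form, against
  weights that are even in \<open>s0\<close> and in \<open>\<epsilon>b\<close>, the terms with a single factor \<open>b\<close> are odd and
  have mean zero. The independence of \<open>s0\<close> and \<open>\<epsilon>b\<close> factors all other terms, once \<open>b\<^sup>2\<close> is
  written in the coordinates of \<open>s0\<close>, and the expansions need no more than the second, fourth
  and sixth moments of \<open>\<epsilon>b\<close>, whose covariance matrix is diagonal.

  A variance is at most the second moment. The estimator for \<open>K\<close> is \<open>R\<close> times a sum of outer
  products, bounded in the Frobenius norm by the Cauchy--Schwarz inequality; the one for \<open>l\<close> is
  \<open>R\<close> times a sum of the vectors with entries \<open>z\<^sup>2 - 1\<close>, where \<open>z\<close> is the whitened noise.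
\<close>

section \<open>Random variables with moments of all orders\<close>

definition all_moments :: "'a measure \<Rightarrow> ('a \<Rightarrow> real) \<Rightarrow> bool" where
  "all_moments M f \<longleftrightarrow> f \<in> borel_measurable M \<and> (\<forall>k. integrable M (\<lambda>x. \<bar>f x\<bar> ^ k))"

lemma all_moments_measurable: "all_moments M f \<Longrightarrow> f \<in> borel_measurable M"
  by (simp add: all_moments_def)

lemma all_moments_abs_power: "all_moments M f \<Longrightarrow> integrable M (\<lambda>x. \<bar>f x\<bar> ^ k)"
  by (simp add: all_moments_def)

lemma all_moments_integrable:
  assumes "all_moments M f" shows "integrable M f"
proof -
  have "integrable M (\<lambda>x. \<bar>f x\<bar>)"
    using all_moments_abs_power[OF assms, of 1] by (simp only: power_one_right)
  then show ?thesis
    using all_moments_measurable[OF assms] by (rule integrable_abs_cancel)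
qed

lemma (in prob_space) all_moments_const: "all_moments M (\<lambda>_. c)"
  by (simp add: all_moments_def)

text \<open>There is one bound for each exponent, because the functions that dominate a power of a
  sum or of a product change with the exponent.\<close>

lemma all_moments_dominated:
  assumes "h \<in> borel_measurable M" "\<And>k. integrable M (B k)" "\<And>k x. \<bar>h x\<bar> ^ k \<le> B k x"
  shows "all_moments M h"
  unfolding all_moments_def
proof (intro conjI allI)
  fix k
  have [measurable]: "h \<in> borel_measurable M" by fact
  show "integrable M (\<lambda>x. \<bar>h x\<bar> ^ k)"
  proof (rule Bochner_Integration.integrable_bound)
    show "integrable M (B k)" by fact
    show "AE x in M. norm (\<bar>h x\<bar> ^ k) \<le> norm (B k x)"
    proof (rule AE_I2)
      fix x
      have "norm (\<bar>h x\<bar> ^ k) = \<bar>h x\<bar> ^ k" by (simp only: real_norm_def power_abs abs_idempotent)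
      also have "\<dots> \<le> B k x" by fact
      finally show "norm (\<bar>h x\<bar> ^ k) \<le> norm (B k x)"
        unfolding real_norm_def using abs_ge_self[of "B k x"] by (rule order_trans)
    qed
  qed measurable
qed fact

lemma abs_add_power_le: "\<bar>a + b\<bar> ^ k \<le> 2 ^ k * (\<bar>a\<bar> ^ k + \<bar>b\<bar> ^ k)" for a b :: real
proof -
  have "\<bar>a + b\<bar> ^ k \<le> (2 * max \<bar>a\<bar> \<bar>b\<bar>) ^ k"
    by (intro power_mono) auto
  also have "\<dots> = 2 ^ k * max \<bar>a\<bar> \<bar>b\<bar> ^ k"
    by (rule power_mult_distrib)
  also have "\<dots> \<le> 2 ^ k * (\<bar>a\<bar> ^ k + \<bar>b\<bar> ^ k)"
  proof (rule mult_left_mono)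
    show "max \<bar>a\<bar> \<bar>b\<bar> ^ k \<le> \<bar>a\<bar> ^ k + \<bar>b\<bar> ^ k"
      by (cases "\<bar>a\<bar> \<le> \<bar>b\<bar>") (simp_all add: max_def)
  qed simp
  finally show ?thesis .
qed

lemma all_moments_add:
  assumes "all_moments M f" "all_moments M g"
  shows "all_moments M (\<lambda>x. f x + g x)"
proof (rule all_moments_dominated)
  show "(\<lambda>x. f x + g x) \<in> borel_measurable M"
    using assms[THEN all_moments_measurable] by (rule borel_measurable_add)
  show "integrable M (\<lambda>x. 2 ^ k * (\<bar>f x\<bar> ^ k + \<bar>g x\<bar> ^ k))" for k
    using assms by (intro integrable_mult_right Bochner_Integration.integrable_add all_moments_abs_power)
qed (rule abs_add_power_le)

text \<open>By a b \<le> a^2 + b^2, the moment of order k of a product is controlled by the moments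
  of order 2 k of its factors. This doubling is why the class asks for all orders.\<close>

lemma all_moments_mult:
  assumes "all_moments M f" "all_moments M g"
  shows "all_moments M (\<lambda>x. f x * g x)"
proof (rule all_moments_dominated)
  show "(\<lambda>x. f x * g x) \<in> borel_measurable M"
    using assms[THEN all_moments_measurable] by (rule borel_measurable_times)
  show "integrable M (\<lambda>x. \<bar>f x\<bar> ^ (2 * k) + \<bar>g x\<bar> ^ (2 * k))" for k
    using assms by (intro Bochner_Integration.integrable_add all_moments_abs_power)
  fix k x
  have "a * b \<le> a\<^sup>2 + b\<^sup>2" if "0 \<le> a" "0 \<le> b" for a b :: real
    using sum_squares_bound[of a b] that mult_nonneg_nonneg[of a b] by linarith
  from this[of "\<bar>f x\<bar> ^ k" "\<bar>g x\<bar> ^ k"]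
  show "\<bar>f x * g x\<bar> ^ k \<le> \<bar>f x\<bar> ^ (2 * k) + \<bar>g x\<bar> ^ (2 * k)"
    by (simp only: abs_mult power_mult_distrib power_even_eq zero_le_power abs_ge_zero)
qed

lemma all_moments_uminus: "all_moments M f \<Longrightarrow> all_moments M (\<lambda>x. - f x)"
  unfolding all_moments_def by (auto intro: borel_measurable_uminus)

lemma all_moments_diff:
  assumes "all_moments M f" "all_moments M g"
  shows "all_moments M (\<lambda>x. f x - g x)"
  using all_moments_add[OF assms(1) all_moments_uminus[OF assms(2)]] by simp

lemma (in prob_space) all_moments_power:
  "all_moments M f \<Longrightarrow> all_moments M (\<lambda>x. f x ^ k)"
proof (induction k)
  case 0 then show ?case by (simp only: power_0 all_moments_const)
next
  case (Suc k) then show ?case unfolding power_Suc by (intro all_moments_mult)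
qed

lemma (in prob_space) all_moments_sum:
  "(\<And>i. i \<in> I \<Longrightarrow> all_moments M (f i)) \<Longrightarrow> all_moments M (\<lambda>x. \<Sum>i\<in>I. f i x)"
proof (induction I rule: infinite_finite_induct)
  case (insert i I)
  then have "all_moments M (\<lambda>x. f i x + (\<Sum>i\<in>I. f i x))" by (intro all_moments_add) auto
  with insert(1,2) show ?case by simp
qed (simp_all add: all_moments_const)

lemma (in prob_space) all_moments_matrix_vector:
  assumes "\<And>j. all_moments M (\<lambda>x. u x $ j)"
  shows "all_moments M (\<lambda>x. (A *v u x) $ i)"
  unfolding matrix_vector_mult_def vec_lambda_beta
  by (intro all_moments_sum all_moments_mult all_moments_const assms)

lemma (in prob_space) all_moments_inner:
  fixes u v :: "'a \<Rightarrow> real^'k"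
  assumes "\<And>j. all_moments M (\<lambda>x. u x $ j)" "\<And>j. all_moments M (\<lambda>x. v x $ j)"
  shows "all_moments M (\<lambda>x. u x \<bullet> v x)"
  unfolding inner_vec_def inner_real_def
  by (intro all_moments_sum all_moments_mult assms)

lemma (in prob_space) all_moments_quad:
  assumes "\<And>j. all_moments M (\<lambda>x. u x $ j)"
  shows "all_moments M (\<lambda>x. u x \<bullet> (A *v u x))"
  by (intro all_moments_inner all_moments_matrix_vector assms)

lemma all_moments_distr:
  assumes "X \<in> measurable M N" "f \<in> borel_measurable N"
  shows "all_moments (distr M N X) f \<longleftrightarrow> all_moments M (\<lambda>x. f (X x))"
proof -
  have "(\<lambda>x. \<bar>f x\<bar> ^ k) \<in> borel_measurable N" for k
    using assms(2) by measurable
  then have "integrable (distr M N X) (\<lambda>x. \<bar>f x\<bar> ^ k) \<longleftrightarrow> integrable M (\<lambda>x. \<bar>f (X x)\<bar> ^ k)" for k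
    by (rule integrable_distr_eq[OF assms(1)])
  then show ?thesis
    using assms(2) measurable_compose[OF assms] by (simp add: all_moments_def)
qed

text \<open>Expanding the square leaves E|G|^2 - |E G|^2. The hypothesis on the components along
  \<open>Basis\<close> serves vectors and matrices alike.\<close>

lemma (in prob_space) Var_Fro_le_second_moment:
  fixes G :: "'a \<Rightarrow> 'v::euclidean_space"
  assumes "\<And>b. b \<in> Basis \<Longrightarrow> all_moments M (\<lambda>x. G x \<bullet> b)"
  shows "Var_Fro M G \<le> (\<integral>x. (norm (G x))\<^sup>2 \<partial>M)" "integrable M (\<lambda>x. (norm (G x))\<^sup>2)"
proof -
  let ?c = "\<integral>x. G x \<partial>M"
  have [measurable]: "G \<in> borel_measurable M"
    using assms by (subst borel_measurable_euclidean_space) (auto simp: all_moments_def)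
  have sq: "(norm (G x))\<^sup>2 = (\<Sum>b\<in>Basis. (G x \<bullet> b)\<^sup>2)" for x
    using euclidean_inner[of "G x" "G x"] by (simp only: power2_norm_eq_inner power2_eq_square[of "G x \<bullet> _"])
  show i2: "integrable M (\<lambda>x. (norm (G x))\<^sup>2)"
    unfolding sq by (intro all_moments_integrable all_moments_sum all_moments_power assms)
  \<comment> \<open>Expanding the variance requires \<open>G\<close> itself to be integrable; a
    \<le> 1 + a^2 reduces this to its squared norm.\<close>
  have i1: "integrable M G"
  proof (rule Bochner_Integration.integrable_bound)
    show "integrable M (\<lambda>x. 1 + (norm (G x))\<^sup>2)" using i2 by simp
    have "a \<le> 1 + a\<^sup>2" for a :: real
      using sum_squares_bound[of a 1] zero_le_square[of a] unfolding power2_eq_square by linarith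
    then have "norm (G x) \<le> norm (1 + (norm (G x))\<^sup>2)" for x
      unfolding real_norm_def using abs_ge_self by (rule order_trans)
    then show "AE x in M. norm (G x) \<le> norm (1 + (norm (G x))\<^sup>2)"
      by (rule AE_I2)
  qed fact
  have pw: "(norm (G x - ?c))\<^sup>2 = (norm (G x))\<^sup>2 - 2 * (G x \<bullet> ?c) + (norm ?c)\<^sup>2" for x
    by (simp only: power2_norm_eq_inner inner_diff_left inner_diff_right inner_commute[of ?c "G x"])
  have "Var_Fro M G = (\<integral>x. (norm (G x))\<^sup>2 - 2 * (G x \<bullet> ?c) + (norm ?c)\<^sup>2 \<partial>M)"
    unfolding Var_Fro_def pw ..
  also have "\<dots> = (\<integral>x. (norm (G x))\<^sup>2 \<partial>M) - 2 * (?c \<bullet> ?c) + (norm ?c)\<^sup>2"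
    using i1 i2 by (simp add: prob_space)
  also have "\<dots> = (\<integral>x. (norm (G x))\<^sup>2 \<partial>M) - (norm ?c)\<^sup>2"
    by (simp only: power2_norm_eq_inner)
  finally show "Var_Fro M G \<le> (\<integral>x. (norm (G x))\<^sup>2 \<partial>M)" by simp
qed

section \<open>Gaussian vectors\<close>

lemma borel_measurable_vec_iff:
  fixes f :: "'a \<Rightarrow> real^'k"
  shows "f \<in> borel_measurable M \<longleftrightarrow> (\<forall>i. (\<lambda>x. f x $ i) \<in> borel_measurable M)"
  by (subst borel_measurable_euclidean_space) (auto simp: Basis_vec_def inner_axis)

lemma borel_measurable_vec_nth [measurable]:
  fixes f :: "'a \<Rightarrow> real^'k"
  shows "f \<in> borel_measurable M \<Longrightarrow> (\<lambda>x. f x $ i) \<in> borel_measurable M"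
  by (simp add: borel_measurable_vec_iff)

lemma borel_measurable_matrix_vector [measurable]:
  fixes f :: "'a \<Rightarrow> real^'k" and Q :: "real^'k^'r"
  assumes [measurable]: "f \<in> borel_measurable M"
  shows "(\<lambda>x. Q *v f x) \<in> borel_measurable M"
  by (subst borel_measurable_vec_iff) (simp add: matrix_vector_mult_def)

abbreviation std_normal :: "real measure" where
  "std_normal \<equiv> density lborel std_normal_density"

abbreviation std_normals :: "('k \<Rightarrow> real) measure" where
  "std_normals \<equiv> \<Pi>\<^sub>M i\<in>UNIV. std_normal"

lemma prob_space_std_normal: "prob_space std_normal"
  by (rule prob_space_normal_density) simp

interpretation std_normals: product_prob_space "\<lambda>_::'k. std_normal" UNIV
  by (intro product_prob_spaceI prob_space_std_normal)

lemma integrable_std_normal_power: "integrable std_normal (\<lambda>x. x ^ k)"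
  using integrable_std_normal_moment[of k] by (subst integrable_real_density) auto

lemma integral_std_normal_power_odd: "odd k \<Longrightarrow> (\<integral>x. x ^ k \<partial>std_normal) = 0"
  using integral_std_normal_moment_odd by (subst integral_real_density) (auto elim!: oddE)

lemma integral_std_normal_power_even:
  "(\<integral>x. x ^ (2 * k) \<partial>std_normal) = fact (2 * k) / (2 ^ k * fact k)"
  using integral_std_normal_moment_even[of k] by (subst integral_real_density) auto

lemma distr_std_normal_uminus: "distr std_normal std_normal uminus = std_normal"
proof -
  \<comment> \<open>On \<open>std_normal\<close> the identity is a standard normal variable, and the
    reflection is its affine image with shift 0 and slope -1.\<close>
  have "distributed std_normal lborel (\<lambda>x. x) std_normal_density"
    by (auto simp: distributed_def distr_id2 intro!: measure_eqI)
  then have "distributed std_normal lborel (\<lambda>x. 0 + (-1) * x) (normal_density (0 + (-1) * 0) (\<bar>-1\<bar> * 1))"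
    by (intro prob_space.normal_density_affine prob_space_std_normal) auto
  then have "distr std_normal lborel uminus = std_normal"
    by (simp add: distributed_def)
  then show ?thesis
    by (metis (no_types, lifting) distr_cong sets_density)
qed

lemma integrable_std_normals_monomial:
  "integrable std_normals (\<lambda>z::'k::finite \<Rightarrow> real. \<Prod>i\<in>UNIV. z i ^ k i)"
  by (rule std_normals.product_integrable_prod) (simp_all add: integrable_std_normal_power)

lemma integral_std_normals_monomial:
  "(\<integral>z. (\<Prod>i\<in>UNIV. z i ^ k i) \<partial>std_normals) = (\<Prod>i\<in>(UNIV::'k::finite set). \<integral>x. x ^ k i \<partial>std_normal)"
  by (rule std_normals.product_integral_prod) (simp_all add: integrable_std_normal_power)

text \<open>A power of one coordinate becomes a monomial with an exponent at every index, the shape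
  that integration over the product measure expects.\<close>

lemma prod_power_delta:
  fixes z :: "'k::finite \<Rightarrow> real"
  shows "(\<Prod>i\<in>UNIV. z i ^ (if i = j then n else 0)) = z j ^ n"
proof -
  have "(\<Prod>i\<in>UNIV. z i ^ (if i = j then n else 0)) = (\<Prod>i\<in>UNIV. if i = j then z i ^ n else 1)"
    by (intro prod.cong) auto
  then show ?thesis by simp
qed

lemma std_normals_coordinate_moments:
  "all_moments std_normals (\<lambda>z::'k::finite \<Rightarrow> real. z i)"
proof -
  have "integrable std_normals (\<lambda>z::'k \<Rightarrow> real. \<bar>z i\<bar> ^ k)" for k
  proof -
    have "integrable std_normals (\<lambda>z::'k \<Rightarrow> real. z i ^ k)"
      using integrable_std_normals_monomial[of "\<lambda>j. if j = i then k else 0"]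
      by (simp add: prod_power_delta)
    then show ?thesis
      using integrable_abs by (fastforce simp: power_abs)
  qed
  then show ?thesis by (simp add: all_moments_def)
qed

text \<open>Measures on the product agree once they agree on boxes, and there the reflection acts on
  each factor separately. This is the source of all vanishing odd moments.\<close>

lemma distr_std_normals_uminus:
  "distr std_normals std_normals (\<lambda>z i. - z i) = (std_normals :: ('k::finite \<Rightarrow> real) measure)"
proof (rule std_normals.PiM_eqI)
  fix A :: "'k \<Rightarrow> real set" assume A: "\<And>i. i \<in> UNIV \<Longrightarrow> A i \<in> sets std_normal"
  have meas: "(\<lambda>z i. - z i) \<in> measurable std_normals (std_normals :: ('k \<Rightarrow> real) measure)"
    by (rule measurable_PiM_single') (auto simp: space_PiM)
  have inv: "uminus -` A i \<in> sets std_normal" for i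
    using measurable_sets[OF _ A, of uminus std_normal i] by simp
  have "emeasure (distr std_normals std_normals (\<lambda>z i. - z i)) (Pi\<^sub>E UNIV A)
      = emeasure std_normals (Pi\<^sub>E UNIV (\<lambda>i. uminus -` A i))"
    using A meas by (subst emeasure_distr) 
      (auto intro!: arg_cong[where f="emeasure _"] sets_PiM_I_finite simp: space_PiM PiE_iff)
  also have "\<dots> = (\<Prod>i\<in>UNIV. emeasure std_normal (uminus -` A i))"
    using inv by (intro std_normals.emeasure_PiM) auto
  also have "\<dots> = (\<Prod>i\<in>UNIV. emeasure std_normal (A i))"
  proof (intro prod.cong refl)
    fix i
    have "emeasure std_normal (A i) = emeasure (distr std_normal std_normal uminus) (A i)"
      by (simp add: distr_std_normal_uminus)
    also have "\<dots> = emeasure std_normal (uminus -` A i)"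
      using A by (subst emeasure_distr) auto
    finally show "emeasure std_normal (uminus -` A i) = emeasure std_normal (A i)" by simp
  qed
  finally show "emeasure (distr std_normals std_normals (\<lambda>z i. - z i)) (Pi\<^sub>E UNIV A)
      = (\<Prod>i\<in>UNIV. emeasure std_normal (A i))" .
qed simp_all

lemma measurable_vec_lambda_std_normals [measurable]:
  "(\<lambda>z. \<chi> i. z i) \<in> borel_measurable (std_normals :: ('k::finite \<Rightarrow> real) measure)"
  by (subst borel_measurable_vec_iff) simp

lemma prob_space_mv_normal: "prob_space (mv_normal Q)"
  unfolding mv_normal_def by (rule std_normals.prob_space_distr) measurable

lemma sets_mv_normal [measurable_cong, simp]: "sets (mv_normal Q) = sets borel"
  by (simp add: mv_normal_def)

lemma space_mv_normal [simp]: "space (mv_normal Q) = UNIV"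
  by (simp add: mv_normal_def)

lemma integral_mv_normal:
  fixes f :: "real^'k \<Rightarrow> real"
  assumes "f \<in> borel_measurable borel"
  shows "(\<integral>x. f x \<partial>mv_normal Q) = (\<integral>z. f (psd_sqrt Q *v (\<chi> i. z i)) \<partial>std_normals)"
  using assms unfolding mv_normal_def by (subst integral_distr) auto

text \<open>Each coordinate is a fixed linear combination of standard normal variables, so the
  closure rules apply, also for a singular covariance.\<close>

lemma mv_normal_coordinate_moments: "all_moments (mv_normal Q) (\<lambda>x. x $ i)"
  unfolding mv_normal_def
  by (subst all_moments_distr)
     (auto intro!: std_normals.all_moments_matrix_vector std_normals_coordinate_moments)

lemma integral_mv_normal_uminus:
  fixes f :: "real^'k \<Rightarrow> real"
  assumes f: "f \<in> borel_measurable borel"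
  shows "(\<integral>x. f (- x) \<partial>mv_normal Q) = (\<integral>x. f x \<partial>mv_normal Q)"
proof -
  let ?L = "\<lambda>z. psd_sqrt Q *v (\<chi> i. z i)"
  have meas: "(\<lambda>z i. - z i) \<in> measurable std_normals (std_normals :: ('k \<Rightarrow> real) measure)"
    by (rule measurable_PiM_single') (auto simp: space_PiM)
  have neg: "?L (\<lambda>i. - z i) = - ?L z" for z
    by (simp add: matrix_vector_mult_def vec_eq_iff sum_negf)
  have "(\<integral>x. f x \<partial>mv_normal Q) = (\<integral>z. f (?L z) \<partial>distr std_normals std_normals (\<lambda>z i. - z i))"
    using f by (simp add: integral_mv_normal distr_std_normals_uminus)
  also have "\<dots> = (\<integral>z. f (- ?L z) \<partial>std_normals)"
    using f meas by (subst integral_distr) (auto simp: neg)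
  also have "\<dots> = (\<integral>x. f (- x) \<partial>mv_normal Q)"
    using f by (subst integral_mv_normal) auto
  finally show ?thesis by simp
qed

lemma integral_mv_normal_odd:
  fixes f :: "real^'k \<Rightarrow> real"
  assumes "f \<in> borel_measurable borel" "\<And>x. f (- x) = - f x"
  shows "(\<integral>x. f x \<partial>mv_normal Q) = 0"
  using integral_mv_normal_uminus[OF assms(1), of Q] assms(2) by simp

section \<open>Diagonal covariance matrices\<close>

lemma diag_nth [simp]: "diag v $ i $ j = (if i = j then v $ i else 0)"
  by (simp add: diag_def)

lemma diag_mult_vector: "diag v *v x = (\<chi> i. v $ i * x $ i)"
proof -
  have "(\<Sum>j\<in>UNIV. (if i = j then v $ i else 0) * x $ j) = v $ i * x $ i" for i
    by (simp add: if_distrib[of "\<lambda>c. c * _"] cong: if_cong)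
  then show ?thesis by (simp add: matrix_vector_mult_def)
qed

lemma diag_mult_diag: "diag v ** diag w = diag (\<chi> i. v $ i * w $ i)"
proof -
  have "(\<Sum>k\<in>UNIV. (if i = k then v $ i else 0) * (if k = j then w $ k else 0))
      = (if i = j then v $ i * w $ i else 0)" for i j
    by (simp add: if_distrib[of "\<lambda>c. c * _"] cong: if_cong)
  then show ?thesis by (simp add: vec_eq_iff matrix_matrix_mult_def)
qed

lemma diag_one: "diag (\<chi> i. 1) = mat 1"
  by (simp add: vec_eq_iff mat_def)

lemma transpose_diag: "transpose (diag v) = diag v"
  by (simp add: vec_eq_iff transpose_def)

lemma inner_diag: "x \<bullet> (diag v *v x) = (\<Sum>i\<in>UNIV. v $ i * (x $ i)\<^sup>2)"
  by (simp add: inner_vec_def diag_mult_vector power2_eq_square mult_ac)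

lemma matrix_inv_diag:
  assumes "\<And>i. v $ i \<noteq> 0"
  shows "matrix_inv (diag v) = diag (\<chi> i. inverse (v $ i))"
proof -
  have 1: "diag v ** diag (\<chi> i. inverse (v $ i)) = mat 1" "diag (\<chi> i. inverse (v $ i)) ** diag v = mat 1"
    using assms by (simp_all add: diag_mult_diag diag_one)
  \<comment> \<open>\<open>matrix_inv\<close> is a choice: the explicit inverse in 1 shows that the
    chosen matrix is an inverse too, and cancelling \<open>diag v\<close> then identifies the
    two.\<close>
  then have 2: "matrix_inv (diag v) ** diag v = mat 1"
    unfolding matrix_inv_def by (metis (mono_tags, lifting) someI_ex)
  have "matrix_inv (diag v) = matrix_inv (diag v) ** (diag v ** diag (\<chi> i. inverse (v $ i)))"
    by (simp only: 1 matrix_mul_rid)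
  also have "\<dots> = diag (\<chi> i. inverse (v $ i))"
    by (simp only: matrix_mul_assoc 2 matrix_mul_lid)
  finally show ?thesis .
qed

lemma psd_diag: "(\<And>i. 0 \<le> v $ i) \<Longrightarrow> psd (diag v)"
  by (auto simp: psd_def transpose_diag inner_diag intro!: sum_nonneg)

text \<open>
  Uniqueness of the square root: \<open>L ** L\<close> commutes with \<open>L\<close>, so \<open>L\<close> also commutes with
  \<open>D = diag c\<close>, and \<open>L\<^sup>2 = D\<^sup>2\<close> factors as \<open>(L - D)(L + D) = 0\<close> with \<open>L + D\<close> invertible.
\<close>

lemma psd_sqrt_diag:
  fixes c :: "real^'k"
  assumes c: "\<And>i. 0 < c $ i"
  shows "psd_sqrt (diag (\<chi> i. (c $ i)\<^sup>2)) = diag c"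
  unfolding psd_sqrt_def
proof (rule the_equality, intro conjI)
  let ?D = "diag c"
  show "psd ?D" using c by (simp add: psd_diag less_imp_le)
  show D2: "?D ** ?D = diag (\<chi> i. (c $ i)\<^sup>2)"
    by (simp add: diag_mult_diag power2_eq_square)
  fix L :: "real^'k^'k"
  assume L: "psd L \<and> L ** L = diag (\<chi> i. (c $ i)\<^sup>2)"
  have row: "(\<Sum>k\<in>UNIV. (if i = k then v $ i else 0) * f k) = v $ i * f i"
    and col: "(\<Sum>k\<in>UNIV. f k * (if k = j then v $ k else 0)) = f j * v $ j" for i j v and f :: "'k \<Rightarrow> real"
    by (simp_all add: if_distrib[of "\<lambda>c. c * _"] if_distrib[of "\<lambda>c. _ * c"] cong: if_cong)
  have "L ** (L ** L) = (L ** L) ** L" by (simp only: matrix_mul_assoc)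
  then have "L $ i $ j * (c $ j)\<^sup>2 = (c $ i)\<^sup>2 * L $ i $ j" for i j
    using L by (simp add: vec_eq_iff matrix_matrix_mult_def row col)
  \<comment> \<open>An entry of \<open>L\<close> can be nonzero only where the squares of
    \<open>c\<close> agree, hence, by positivity, where \<open>c\<close> itself agrees. This passes
    from commuting with the square to commuting with \<open>?D\<close>.\<close>
  then have z: "L $ i $ j = 0 \<or> c $ i = c $ j" for i j
    using power2_eq_iff_nonneg[of "c $ j" "c $ i"] c[of i] c[of j]
    by (metis less_imp_le mult.commute mult_left_cancel)
  have comm: "L ** ?D = ?D ** L"
    unfolding vec_eq_iff matrix_matrix_mult_def vec_lambda_beta diag_nth row col
    using z by (metis mult.commute mult_zero_left)
  have fact: "(L - ?D) ** (L + ?D) = 0"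
  proof -
    have "(L - ?D) ** (L + ?D) = L ** L + L ** ?D - (?D ** L + ?D ** ?D)"
      by (simp add: vec_eq_iff matrix_matrix_mult_def algebra_simps sum.distrib sum_subtractf)
    then show ?thesis using L D2 comm by simp
  qed
  \<comment> \<open>\<open>L\<close> is only semidefinite, but the quadratic form of
    \<open>?D\<close> is strictly positive away from 0, so the sum has trivial kernel.\<close>
  have "x = 0" if "(L + ?D) *v x = 0" for x
  proof -
    have "x \<bullet> (L *v x) + x \<bullet> (?D *v x) = 0"
      using that by (metis inner_add_right inner_zero_right matrix_vector_mult_add_rdistrib)
    moreover have "0 \<le> x \<bullet> (L *v x)" using L by (simp add: psd_def)
    moreover have nn: "0 \<le> c $ i * (x $ i)\<^sup>2" for i using c[of i] by simp
    ultimately have "(\<Sum>i\<in>UNIV. c $ i * (x $ i)\<^sup>2) \<le> 0" by (simp add: inner_diag)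
    then have "(\<Sum>i\<in>UNIV. c $ i * (x $ i)\<^sup>2) = 0"
      by (intro antisym sum_nonneg nn)
    then have "\<forall>i. c $ i * (x $ i)\<^sup>2 = 0"
      using nn by (subst (asm) sum_nonneg_eq_0_iff) auto
    then show "x = 0" using c by (auto simp: vec_eq_iff less_imp_neq[symmetric])
  qed
  then obtain N where N: "N ** (L + ?D) = mat 1"
    using matrix_left_invertible_ker[of "L + ?D"] by auto
  then have "(L + ?D) ** N = mat 1" by (simp add: matrix_left_right_inverse)
  then have "L - ?D = ((L - ?D) ** (L + ?D)) ** N" by (simp only: matrix_mul_assoc[symmetric] matrix_mul_rid)
  then have "L - ?D = 0" unfolding fact by (simp add: vec_eq_iff matrix_matrix_mult_def)
  then show "L = ?D" by simp
qed

lemma kron_mat_1_diag: "kron (mat 1) (diag v) = diag (\<chi> p. v $ snd p)"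
  by (auto simp: vec_eq_iff kron_def mat_def)

section \<open>Joint moments of independent standard normal variables up to order six\<close>

lemma measure_std_normal_UNIV: "measure std_normal UNIV = 1"
  using prob_space.prob_space[OF prob_space_std_normal]
  by (simp only: space_density space_lborel space_borel)

text \<open>The values are the double factorials (2 k - 1)!!. The last two equations restate the
  second and fourth moments with the powers multiplied out, for rewriting.\<close>

lemma std_normal_moments:
  "(\<integral>x. x ^ 0 \<partial>std_normal) = 1" "(\<integral>x. x ^ 2 \<partial>std_normal) = 1"
  "(\<integral>x. x ^ 4 \<partial>std_normal) = 3" "(\<integral>x. x ^ 6 \<partial>std_normal) = 15"
  "(\<integral>x. x * x \<partial>std_normal) = 1" "(\<integral>x. x * (x * (x * x)) \<partial>std_normal) = 3"
  using integral_std_normal_power_even[of 0] integral_std_normal_power_even[of 1]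
    integral_std_normal_power_even[of 2] integral_std_normal_power_even[of 3]
  by (simp_all add: fact_numeral power_numeral_reduce)

text \<open>The exponents in \<open>k\<close> add up wherever indices coincide, so one formula
  covers all coincidences; choosing \<open>a\<close> and \<open>b\<close> among 0 and 1 gives the
  moments of orders two, four and six.\<close>

lemma integral_std_normals_six:
  fixes p q r s :: "'k::finite" and a b :: nat
  defines "k \<equiv> (\<lambda>i. (if i = r then 2 * a else 0) + (if i = s then 2 * b else 0)
                    + (if i = p then 1 else 0) + (if i = q then 1 else 0))"
  shows "(\<integral>z. z r ^ (2 * a) * z s ^ (2 * b) * (z p * z q) \<partial>std_normals)
    = (\<Prod>i\<in>UNIV. \<integral>x. x ^ k i \<partial>std_normal)"
proof -
  have "z r ^ (2 * a) * z s ^ (2 * b) * (z p * z q) = (\<Prod>i\<in>UNIV. z i ^ k i)" for z :: "'k \<Rightarrow> real"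
    unfolding k_def power_add prod.distrib prod_power_delta by simp
  then show ?thesis by (simp only: integral_std_normals_monomial)
qed

text \<open>The index \<open>p\<close> receives exponent 1 from itself, none from \<open>q\<close>,
  and even exponents from \<open>r\<close> and \<open>s\<close>. Its factor is therefore an odd
  moment.\<close>

lemma integral_std_normals_six_off_diagonal:
  fixes p q r s :: "'k::finite"
  assumes "p \<noteq> q"
  shows "(\<integral>z. z r ^ (2 * a) * z s ^ (2 * b) * (z p * z q) \<partial>std_normals) = 0"
  unfolding integral_std_normals_six
proof (rule prod_zero)
  show "\<exists>i\<in>UNIV. (\<integral>x. x ^ ((if i = r then 2 * a else 0) + (if i = s then 2 * b else 0)
      + (if i = p then 1 else 0) + (if i = q then 1 else 0)) \<partial>std_normal) = 0"
    using assms by (intro bexI[of _ p] integral_std_normal_power_odd) auto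
qed simp

text \<open>The right-hand side encodes the coincidence patterns: 1 for three distinct indices, 3
  when exactly two agree, and 3 * 5 = 15 when all agree.\<close>

lemma integral_std_normals_six_diagonal:
  fixes p r s :: "'k::finite"
  defines "\<delta> \<equiv> \<lambda>i j :: 'k. if i = j then 1 else 0 :: real"
  shows "(\<integral>z. (z r)\<^sup>2 * (z s)\<^sup>2 * (z p * z p) \<partial>std_normals)
    = (1 + 2 * \<delta> r s) * (1 + 2 * \<delta> r p + 2 * \<delta> s p)"
proof -
  let ?k = "\<lambda>i. (if i = r then 2 * 1 else 0) + (if i = s then 2 * 1 else 0)
                    + (if i = p then 1 else 0) + (if i = p then 1 else 0) :: nat"
  have "(\<integral>z. (z r)\<^sup>2 * (z s)\<^sup>2 * (z p * z p) \<partial>std_normals) = (\<Prod>i\<in>UNIV. \<integral>x. x ^ ?k i \<partial>std_normal)"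
    using integral_std_normals_six[of r 1 s 1 p p] by (simp only: mult_1_right)
  \<comment> \<open>Every other index contributes a moment of order 0, which is 1. The set collapses
    when indices coincide, hence the case split below.\<close>
  also have "\<dots> = (\<Prod>i\<in>{r,s,p}. \<integral>x. x ^ ?k i \<partial>std_normal)"
    by (rule prod.mono_neutral_right) (auto simp: measure_std_normal_UNIV)
  also have "\<dots> = (1 + 2 * \<delta> r s) * (1 + 2 * \<delta> r p + 2 * \<delta> s p)"
    by (cases "r = s"; cases "r = p"; cases "s = p")
       (simp_all add: \<delta>_def std_normal_moments insert_commute)
  finally show ?thesis .
qed

lemma integral_std_normals_square_pair:
  fixes p q r :: "'k::finite"
  defines "\<delta> \<equiv> \<lambda>i j :: 'k. if i = j then 1 else 0 :: real"
  shows "(\<integral>z. (z r)\<^sup>2 * (z p * z q) \<partial>std_normals) = \<delta> p q * (1 + 2 * \<delta> r p)"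
proof (cases "p = q")
  case True
  let ?k = "\<lambda>i. (if i = r then 2 * 1 else 0) + (if i = r then 2 * 0 else 0)
                    + (if i = p then 1 else 0) + (if i = p then 1 else 0) :: nat"
  have "(\<integral>z. (z r)\<^sup>2 * (z p * z p) \<partial>std_normals) = (\<Prod>i\<in>UNIV. \<integral>x. x ^ ?k i \<partial>std_normal)"
    using integral_std_normals_six[of r 1 r 0 p p] by (simp only: mult_1_right mult_0_right power_0)
  also have "\<dots> = (\<Prod>i\<in>{r,p}. \<integral>x. x ^ ?k i \<partial>std_normal)"
    by (rule prod.mono_neutral_right) (auto simp: measure_std_normal_UNIV)
  also have "\<dots> = 1 + 2 * \<delta> r p"
    by (cases "r = p") (simp_all add: \<delta>_def std_normal_moments insert_commute)
  finally show ?thesis using True by (simp add: \<delta>_def)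
next
  case False
  then show ?thesis
    using integral_std_normals_six_off_diagonal[of p q r 1 r 0] by (simp add: \<delta>_def)
qed

lemma integral_std_normals_pair:
  fixes p q :: "'k::finite"
  shows "(\<integral>z. z p * z q \<partial>std_normals) = (if p = q then 1 else 0)"
proof (cases "p = q")
  case True
  let ?k = "\<lambda>i. (if i = p then 2 * 0 else 0) + (if i = p then 2 * 0 else 0)
                    + (if i = p then 1 else 0) + (if i = p then 1 else 0) :: nat"
  have "(\<integral>z. z p * z p \<partial>std_normals) = (\<Prod>i\<in>UNIV. \<integral>x. x ^ ?k i \<partial>std_normal)"
    using integral_std_normals_six[of p 0 p 0 p p] by (simp only: mult_1_left mult_0_right power_0)
  also have "\<dots> = (\<Prod>i\<in>{p}. \<integral>x. x ^ ?k i \<partial>std_normal)"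
    by (rule prod.mono_neutral_right) (auto simp: measure_std_normal_UNIV)
  also have "\<dots> = 1"
    by (simp add: std_normal_moments)
  finally show ?thesis using True by simp
next
  case False
  then show ?thesis
    using integral_std_normals_six_off_diagonal[of p q p 0 p 0] by simp
qed

section \<open>Weighted second moments under a diagonal covariance, by rescaling independent
  standard normals\<close>

lemma integral_mv_normal_diag:
  fixes c :: "real^'k" and f :: "real^'k \<Rightarrow> real"
  assumes "\<And>i. 0 < c $ i" "f \<in> borel_measurable borel"
  shows "(\<integral>x. f x \<partial>mv_normal (diag (\<chi> i. (c $ i)\<^sup>2))) = (\<integral>z. f (\<chi> i. c $ i * z i) \<partial>std_normals)"
  using assms by (simp add: integral_mv_normal psd_sqrt_diag diag_mult_vector)

lemma integral_mv_normal_diag_pair: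
  fixes c :: "real^'k"
  assumes c: "\<And>i. 0 < c $ i"
  shows "(\<integral>x. x $ p * x $ q \<partial>mv_normal (diag (\<chi> i. (c $ i)\<^sup>2))) = (if p = q then (c $ p)\<^sup>2 else 0)"
proof -
  have "(\<integral>x. x $ p * x $ q \<partial>mv_normal (diag (\<chi> i. (c $ i)\<^sup>2)))
      = (\<integral>z. (c $ p * c $ q) * (z p * z q) \<partial>std_normals)"
    by (subst integral_mv_normal_diag[OF c]) (auto simp: mult_ac)
  also have "\<dots> = (if p = q then (c $ p)\<^sup>2 else 0)"
    by (simp add: integral_std_normals_pair power2_eq_square)
  finally show ?thesis .
qed

lemma integral_mv_normal_diag_quad:
  fixes c w :: "real^'k"
  assumes c: "\<And>i. 0 < c $ i"
  shows "(\<integral>x. x \<bullet> (diag w *v x) \<partial>mv_normal (diag (\<chi> i. (c $ i)\<^sup>2))) = (\<Sum>r\<in>UNIV. w $ r * (c $ r)\<^sup>2)"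
proof -
  have "(\<integral>x. x \<bullet> (diag w *v x) \<partial>mv_normal Q) = (\<Sum>r\<in>UNIV. w $ r * (\<integral>x. x $ r * x $ r \<partial>mv_normal Q))" for Q
    unfolding inner_diag power2_eq_square integral_mult_right_zero[symmetric]
    by (intro Bochner_Integration.integral_sum all_moments_integrable all_moments_mult
        prob_space.all_moments_const prob_space_mv_normal mv_normal_coordinate_moments)
  then show ?thesis by (simp only: integral_mv_normal_diag_pair[OF c] refl if_True)
qed

text \<open>This is Isserlis's formula for diagonal matrices W and covariance C: the moment is tr(W
  C) times an entry of C, plus twice the corresponding entry of C W C.\<close>

lemma integral_mv_normal_diag_quad_pair:
  fixes c w :: "real^'k"
  assumes c: "\<And>i. 0 < c $ i"
  shows "(\<integral>x. x \<bullet> (diag w *v x) * (x $ p * x $ q) \<partial>mv_normal (diag (\<chi> i. (c $ i)\<^sup>2)))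
    = (if p = q then (c $ p)\<^sup>2 * ((\<Sum>r\<in>UNIV. w $ r * (c $ r)\<^sup>2) + 2 * (w $ p * (c $ p)\<^sup>2)) else 0)"
proof -
  have "(\<integral>x. x \<bullet> (diag w *v x) * (x $ p * x $ q) \<partial>mv_normal (diag (\<chi> i. (c $ i)\<^sup>2)))
      = (\<integral>z. (\<Sum>r\<in>UNIV. (w $ r * (c $ r)\<^sup>2 * (c $ p * c $ q)) * ((z r * z r) * (z p * z q))) \<partial>std_normals)"
    unfolding inner_diag
    by (subst integral_mv_normal_diag[OF c])
       (auto simp: power2_eq_square sum_distrib_left sum_distrib_right mult_ac)
  also have "\<dots> = (\<Sum>r\<in>UNIV. (\<integral>z. (w $ r * (c $ r)\<^sup>2 * (c $ p * c $ q)) * ((z r * z r) * (z p * z q)) \<partial>std_normals))"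
    by (intro Bochner_Integration.integral_sum all_moments_integrable all_moments_mult
        std_normals.all_moments_const std_normals_coordinate_moments)
  also have "\<dots> = (\<Sum>r\<in>UNIV. w $ r * (c $ r)\<^sup>2 * (c $ p * c $ q)
                     * ((if p = q then 1 else 0) * (1 + 2 * (if r = p then 1 else 0))))"
    unfolding integral_mult_right_zero power2_eq_square[symmetric] integral_std_normals_square_pair ..
  also have "\<dots> = (if p = q then (\<Sum>r\<in>UNIV. (c $ p)\<^sup>2 * (w $ r * (c $ r)\<^sup>2)
                     + (if r = p then 2 * (c $ p)\<^sup>2 * (w $ p * (c $ p)\<^sup>2) else 0)) else 0)"
    by (auto intro!: sum.cong simp: power2_eq_square algebra_simps)
  also have "\<dots> = (if p = q then (c $ p)\<^sup>2 * ((\<Sum>r\<in>UNIV. w $ r * (c $ r)\<^sup>2) + 2 * (w $ p * (c $ p)\<^sup>2)) else 0)"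
    by (simp add: sum.distrib sum_distrib_left algebra_simps)
  finally show ?thesis .
qed

text \<open>The sum is E[|z|^4 z_p^2] for d independent standard normals. Summing over
  \<open>s\<close> gives (d + 4)(1 + 2 \<delta>_rp), and summing over \<open>r\<close> turns the
  second factor into d + 2. Equivalently, it is the second moment of a chi-square variable with d +
  2 degrees of freedom.\<close>

lemma sum_six_moments:
  fixes p :: "'k::finite"
  defines "\<delta> \<equiv> \<lambda>i j :: 'k. if i = j then 1 else 0 :: real"
  shows "(\<Sum>r\<in>UNIV. \<Sum>s\<in>UNIV. (1 + 2 * \<delta> r s) * (1 + 2 * \<delta> r p + 2 * \<delta> s p))
    = (real CARD('k) + 2) * (real CARD('k) + 4)"
proof -
  have pick: "(\<Sum>s\<in>UNIV. f s * \<delta> s j) = f j" "(\<Sum>s\<in>UNIV. f s * \<delta> j s) = f j" for j and f :: "'k \<Rightarrow> real"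
    by (simp_all add: \<delta>_def if_distrib[of "\<lambda>c. _ * c"] cong: if_cong)
  have "(\<Sum>s\<in>UNIV. (1 + 2 * \<delta> r s) * (1 + 2 * \<delta> r p + 2 * \<delta> s p))
      = (\<Sum>s\<in>UNIV. (1 + 2 * \<delta> r p) + 2 * \<delta> s p + (2 + 4 * \<delta> r p) * \<delta> r s + (4 * \<delta> s p) * \<delta> r s)" for r
    by (intro sum.cong) (auto simp: algebra_simps)
  also have "\<dots> r = real CARD('k) * (1 + 2 * \<delta> r p) + 2 + (2 + 4 * \<delta> r p) + 4 * \<delta> r p" for r
    using pick(1)[of "\<lambda>_. 2" p] by (simp add: sum.distrib pick)
  also have "\<dots> r = (real CARD('k) + 4) + (2 * real CARD('k) + 8) * \<delta> r p" for r
    by (simp add: algebra_simps)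
  finally have "(\<Sum>r\<in>UNIV. \<Sum>s\<in>UNIV. (1 + 2 * \<delta> r s) * (1 + 2 * \<delta> r p + 2 * \<delta> s p))
     = real CARD('k) * (real CARD('k) + 4) + (2 * real CARD('k) + 8)"
    by (simp add: sum.distrib pick)
  then show ?thesis by (simp add: algebra_simps)
qed

text \<open>In the coordinates x_i = c_i z_i the quadratic form of the inverse covariance is |z|^2,
  so only the sixth moments of z are needed.\<close>

lemma integral_mv_normal_diag_whitened:
  fixes c :: "real^'k"
  assumes c: "\<And>i. 0 < c $ i"
  shows "(\<integral>x. (x \<bullet> (diag (\<chi> i. inverse ((c $ i)\<^sup>2)) *v x))\<^sup>2 * (x $ p * x $ q) \<partial>mv_normal (diag (\<chi> i. (c $ i)\<^sup>2)))
    = (if p = q then (c $ p)\<^sup>2 * ((real CARD('k) + 2) * (real CARD('k) + 4)) else 0)"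
proof -
  have w: "inverse ((c $ i)\<^sup>2) * (c $ i * a)\<^sup>2 = a\<^sup>2" for i a
    using c[of i] by (simp add: power_mult_distrib)
  have "(\<integral>x. (x \<bullet> (diag (\<chi> i. inverse ((c $ i)\<^sup>2)) *v x))\<^sup>2 * (x $ p * x $ q) \<partial>mv_normal (diag (\<chi> i. (c $ i)\<^sup>2)))
      = (\<integral>z. (\<Sum>r\<in>UNIV. (z r)\<^sup>2)\<^sup>2 * (c $ p * z p * (c $ q * z q)) \<partial>std_normals)"
    unfolding inner_diag by (subst integral_mv_normal_diag[OF c]) (auto simp: w)
  also have "\<dots> = (\<integral>z. (\<Sum>r\<in>UNIV. \<Sum>s\<in>UNIV. (c $ p * c $ q) * ((z r)\<^sup>2 * (z s)\<^sup>2 * (z p * z q))) \<partial>std_normals)"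
    by (intro Bochner_Integration.integral_cong refl)
       (simp add: power2_eq_square[of "sum _ _"] sum_product sum_distrib_left sum_distrib_right mult_ac)
  also have "\<dots> = (\<Sum>r\<in>UNIV. \<Sum>s\<in>UNIV. (c $ p * c $ q) * (\<integral>z. ((z r)\<^sup>2 * (z s)\<^sup>2 * (z p * z q)) \<partial>std_normals))"
    unfolding integral_mult_right_zero[symmetric]
    by (subst Bochner_Integration.integral_sum, intro all_moments_integrable std_normals.all_moments_sum all_moments_mult
        std_normals.all_moments_power std_normals.all_moments_const std_normals_coordinate_moments)
       (intro sum.cong refl Bochner_Integration.integral_sum all_moments_integrable std_normals.all_moments_sum all_moments_mult
        std_normals.all_moments_power std_normals.all_moments_const std_normals_coordinate_moments)
  also have "\<dots> = (if p = q then (c $ p)\<^sup>2 * ((real CARD('k) + 2) * (real CARD('k) + 4)) else 0)"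
  proof (cases "p = q")
    case True
    then show ?thesis
      unfolding True integral_std_normals_six_diagonal
      by (simp only: sum_distrib_left[symmetric] sum_six_moments power2_eq_square[symmetric] simp_thms if_True)
  next
    case False
    then show ?thesis
      using integral_std_normals_six_off_diagonal[of p q _ 1 _ 1] by simp
  qed
  finally show ?thesis .
qed

text \<open>A diagonal weighted second-moment matrix D of \<open>v\<close> becomes A D A^T for
  \<open>A *v v\<close>, here entry by entry. The weight is kept abstract because three different
  ones occur: two quartic or quadratic forms in the noise, and the constant 1.\<close>

lemma (in prob_space) integral_weighted_linear_pair:
  fixes v :: "'a \<Rightarrow> real^'k"
  assumes w: "all_moments M w" and v: "\<And>p. all_moments M (\<lambda>x. v x $ p)"
    and cov: "\<And>p q. (\<integral>x. w x * (v x $ p * v x $ q) \<partial>M) = (if p = q then D p else 0)"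
  shows "(\<integral>x. w x * ((A *v v x) $ i * (A *v v x) $ j) \<partial>M) = (\<Sum>p\<in>UNIV. A $ i $ p * A $ j $ p * D p)"
proof -
  have "(\<integral>x. w x * ((A *v v x) $ i * (A *v v x) $ j) \<partial>M)
      = (\<integral>x. (\<Sum>p\<in>UNIV. \<Sum>q\<in>UNIV. (A $ i $ p * A $ j $ q) * (w x * (v x $ p * v x $ q))) \<partial>M)"
    unfolding matrix_vector_mult_def vec_lambda_beta sum_product
    by (intro Bochner_Integration.integral_cong refl) (simp add: sum_distrib_left mult_ac)
  also have "\<dots> = (\<Sum>p\<in>UNIV. \<Sum>q\<in>UNIV. (A $ i $ p * A $ j $ q) * (\<integral>x. w x * (v x $ p * v x $ q) \<partial>M))"
    unfolding integral_mult_right_zero[symmetric]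
    by (subst Bochner_Integration.integral_sum, intro all_moments_integrable all_moments_sum all_moments_mult
         all_moments_const w v)
       (intro sum.cong refl Bochner_Integration.integral_sum all_moments_integrable all_moments_mult
        all_moments_const w v)
  also have "\<dots> = (\<Sum>p\<in>UNIV. A $ i $ p * A $ j $ p * D p)"
    by (simp add: cov if_distrib[of "\<lambda>c. _ * c"] cong: if_cong)
  finally show ?thesis .
qed

section \<open>Independence of the initial state and the lifted noise\<close>

text \<open>
  The variables \<open>X\<close> and \<open>Y t\<close> are embedded in a common product type to make the library's
  results on \<open>indep_vars\<close> applicable.
\<close>

lemma (in prob_space) jointly_indep_imp_indep_vars:
  fixes X :: "'a \<Rightarrow> 'b::euclidean_space" and Y :: "'i \<Rightarrow> 'a \<Rightarrow> 'c::euclidean_space"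
  assumes "jointly_indep M X Y I"
  shows "indep_vars (\<lambda>_. borel) (\<lambda>j \<omega>. case j of None \<Rightarrow> (X \<omega>, 0) | Some t \<Rightarrow> (0, Y t \<omega>))
    (insert None (Some ` I))"
  unfolding indep_vars_def2
proof (intro conjI ballI)
  have [measurable]: "X \<in> borel_measurable M" "\<And>t. t \<in> I \<Longrightarrow> Y t \<in> borel_measurable M"
    using assms by (auto simp: jointly_indep_def)
  fix j assume "j \<in> insert None (Some ` I)"
  then show "(\<lambda>\<omega>. case j of None \<Rightarrow> (X \<omega>, 0 :: 'c) | Some t \<Rightarrow> (0, Y t \<omega>)) \<in> borel_measurable M"
    by (auto intro!: borel_measurable_Pair)
next
  \<comment> \<open>A Borel set of the product pulls back along either embedding to a Borel set, so
    each event of an embedded variable is already an event of the original one.\<close>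
  have emb: "(\<lambda>x. (x, 0)) -` A \<in> sets borel" "Pair 0 -` A \<in> sets borel" if "A \<in> sets borel"
    for A :: "('b \<times> 'c) set"
    using measurable_sets[OF borel_measurable_Pair[of "\<lambda>x. x" borel "\<lambda>_. 0"] that]
      measurable_sets[OF borel_measurable_Pair[of "\<lambda>_. 0" borel "\<lambda>x. x"] that] by simp_all
  have "indep_sets (\<lambda>j. case j of None \<Rightarrow> {X -` Z \<inter> space M | Z. Z \<in> sets borel}
            | Some t \<Rightarrow> {Y t -` Z \<inter> space M | Z. Z \<in> sets borel}) (insert None (Some ` I))"
    using assms by (simp add: jointly_indep_def)
  then show "indep_sets (\<lambda>j. {(\<lambda>\<omega>. case j of None \<Rightarrow> (X \<omega>, 0 :: 'c) | Some t \<Rightarrow> (0, Y t \<omega>)) -` A \<inter> space M | A. A \<in> sets borel})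
       (insert None (Some ` I))"
  proof (rule indep_sets_mono_sets)
    fix j
    show "{(\<lambda>\<omega>. case j of None \<Rightarrow> (X \<omega>, 0 :: 'c) | Some t \<Rightarrow> (0, Y t \<omega>)) -` A \<inter> space M | A. A \<in> sets borel}
      \<subseteq> (case j of None \<Rightarrow> {X -` Z \<inter> space M | Z. Z \<in> sets borel} | Some t \<Rightarrow> {Y t -` Z \<inter> space M | Z. Z \<in> sets borel})"
    proof (cases j)
      case None
      have "(\<lambda>\<omega>. (X \<omega>, 0 :: 'c)) -` A \<inter> space M \<in> {X -` Z \<inter> space M | Z. Z \<in> sets borel}"
        if "A \<in> sets borel" for A
        by (rule CollectI, rule exI[of _ "(\<lambda>x. (x, 0)) -` A"]) (use emb(1)[OF that] in \<open>simp add: vimage_def\<close>)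
      then show ?thesis unfolding None option.case by blast
    next
      case (Some t)
      have "(\<lambda>\<omega>. (0 :: 'b, Y t \<omega>)) -` A \<inter> space M \<in> {Y t -` Z \<inter> space M | Z. Z \<in> sets borel}"
        if "A \<in> sets borel" for A
        by (rule CollectI, rule exI[of _ "Pair 0 -` A"]) (use emb(2)[OF that] in \<open>simp add: vimage_def\<close>)
      then show ?thesis unfolding Some option.case by blast
    qed
  qed
qed

lemma time_less: "time (t::'t::{finite,linorder}) < CARD('t)"
  using bij_betw_time[where 't='t] by (auto simp: bij_betw_def)

text \<open>Disjoint blocks of an independent family are independent. Here the blocks are
  \<open>None\<close> and the indices \<open>Some t\<close>, and the lifted noise is a measurable
  function of the second block since it reads only times below \<open>CARD('t)\<close>.\<close>

lemma (in prob_space) indep_var_lift_noise: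
  fixes s0 :: "'a \<Rightarrow> real^'n" and \<epsilon> :: "nat \<Rightarrow> 'a \<Rightarrow> real^'m"
    and f :: "real^'n \<Rightarrow> real" and g :: "real^('t::{finite,linorder} \<times> 'm) \<Rightarrow> real"
  assumes ind: "jointly_indep M s0 \<epsilon> {..<CARD('t)}"
    and f: "f \<in> borel_measurable borel" and g: "g \<in> borel_measurable borel"
  shows "indep_var borel (\<lambda>\<omega>. f (s0 \<omega>)) borel (\<lambda>\<omega>. g (lift_noise (\<lambda>t. \<epsilon> t \<omega>)))"
proof -
  let ?I = "{..<CARD('t)}"
  let ?Z = "\<lambda>j \<omega>. case j of None \<Rightarrow> (s0 \<omega>, 0 :: real^'m) | Some t \<Rightarrow> (0 :: real^'n, \<epsilon> t \<omega>)"
  let ?f = "\<lambda>h :: nat option \<Rightarrow> (real^'n) \<times> (real^'m). fst (h None)"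
  let ?g = "\<lambda>h :: nat option \<Rightarrow> (real^'n) \<times> (real^'m). lift_noise (\<lambda>t. snd (h (Some t))) :: real^('t \<times> 'm)"
  have iv: "indep_var (PiM {None} (\<lambda>_. borel)) (\<lambda>\<omega>. \<lambda>j\<in>{None}. ?Z j \<omega>)
      (PiM (Some ` ?I) (\<lambda>_. borel)) (\<lambda>\<omega>. \<lambda>j\<in>Some ` ?I. ?Z j \<omega>)"
    by (rule indep_var_restrict[OF jointly_indep_imp_indep_vars[OF ind]]) auto
  have fst: "fst \<in> borel_measurable (borel :: ((real^'n) \<times> (real^'m)) measure)"
    and snd: "snd \<in> borel_measurable (borel :: ((real^'n) \<times> (real^'m)) measure)"
    by (intro borel_measurable_continuous_onI continuous_intros)+
  have "indep_var borel ((\<lambda>h. f (?f h)) \<circ> (\<lambda>\<omega>. \<lambda>j\<in>{None}. ?Z j \<omega>))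
      borel ((\<lambda>h. g (?g h)) \<circ> (\<lambda>\<omega>. \<lambda>j\<in>Some ` ?I. ?Z j \<omega>))"
  proof (rule indep_var_compose[OF iv])
    have "(\<lambda>h. fst (h None)) \<in> borel_measurable (PiM {None} (\<lambda>_. borel :: ((real^'n) \<times> (real^'m)) measure))"
      by (rule measurable_compose[OF _ fst, of "\<lambda>h. h None"]) (rule measurable_component_singleton, simp)
    then show "(\<lambda>h. f (?f h)) \<in> borel_measurable (PiM {None} (\<lambda>_. borel))"
      using f by (rule measurable_compose)
    have 1: "(\<lambda>h. snd (h (Some t))) \<in> borel_measurable (PiM (Some ` ?I) (\<lambda>_. borel :: ((real^'n) \<times> (real^'m)) measure))"
      if "t < CARD('t)" for t
      by (rule measurable_compose[OF _ snd, of "\<lambda>h. h (Some t)"]) (rule measurable_component_singleton, simp add: that)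
    have "?g \<in> borel_measurable (PiM (Some ` ?I) (\<lambda>_. borel))"
      unfolding borel_measurable_vec_iff lift_noise_def vec_lambda_beta
      by (intro allI borel_measurable_vec_nth 1 time_less)
    then show "(\<lambda>h. g (?g h)) \<in> borel_measurable (PiM (Some ` ?I) (\<lambda>_. borel))"
      using g by (rule measurable_compose)
  qed
  moreover have "(\<lambda>h. f (?f h)) \<circ> (\<lambda>\<omega>. \<lambda>j\<in>{None}. ?Z j \<omega>) = (\<lambda>\<omega>. f (s0 \<omega>))"
    by (simp add: fun_eq_iff)
  moreover have "(\<lambda>h. g (?g h)) \<circ> (\<lambda>\<omega>. \<lambda>j\<in>Some ` ?I. ?Z j \<omega>) = (\<lambda>\<omega>. g (lift_noise (\<lambda>t. \<epsilon> t \<omega>)))"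
    by (simp add: fun_eq_iff lift_noise_def time_less)
  ultimately show ?thesis by simp
qed

section \<open>The law of the lifted noise\<close>

lemma mv_normal_diag:
  fixes c :: "real^'k"
  assumes "\<And>i. 0 < c $ i"
  shows "mv_normal (diag (\<chi> i. (c $ i)\<^sup>2)) = distr std_normals borel (\<lambda>z. \<chi> i. c $ i * z i)"
  using assms unfolding mv_normal_def by (simp add: psd_sqrt_diag diag_mult_vector)

lemma sets_box:
  fixes c :: "real^'k"
  assumes A: "\<And>i. A i \<in> sets borel"
  shows "{x :: real^'k. \<forall>i. x $ i / c $ i \<in> A i} \<in> sets borel"
proof -
  have "(\<lambda>x :: real^'k. x $ i / c $ i) -` A i \<in> sets borel" for i
    using measurable_sets[of "\<lambda>x :: real^'k. x $ i / c $ i" borel borel "A i"] A by simp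
  then have "(\<Inter>i\<in>UNIV. (\<lambda>x :: real^'k. x $ i / c $ i) -` A i) \<in> sets borel"
    by (intro sets.finite_INT) auto
  moreover have "(\<Inter>i\<in>UNIV. (\<lambda>x :: real^'k. x $ i / c $ i) -` A i) = {x. \<forall>i. x $ i / c $ i \<in> A i}"
    by auto
  ultimately show ?thesis by simp
qed

lemma emeasure_mv_normal_diag_box:
  fixes c :: "real^'k"
  assumes c: "\<And>i. 0 < c $ i" and A: "\<And>i. A i \<in> sets borel"
  shows "emeasure (mv_normal (diag (\<chi> i. (c $ i)\<^sup>2))) {x. \<forall>i. x $ i / c $ i \<in> A i} = (\<Prod>i\<in>UNIV. emeasure std_normal (A i))"
proof -
  have c0: "c $ i \<noteq> 0" for i using c[of i] by simp
  have meas: "(\<lambda>z. \<chi> i. c $ i * z i) \<in> borel_measurable (std_normals :: ('k \<Rightarrow> real) measure)"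
    by (subst borel_measurable_vec_iff) simp
  note box = sets_box[OF A, of c]
  have "emeasure (mv_normal (diag (\<chi> i. (c $ i)\<^sup>2))) {x. \<forall>i. x $ i / c $ i \<in> A i}
      = emeasure std_normals (Pi\<^sub>E UNIV A)"
    unfolding mv_normal_diag[OF c] using box meas
    by (subst emeasure_distr) (auto intro!: arg_cong[where f="emeasure _"] simp: c0 space_PiM PiE_iff)
  also have "\<dots> = (\<Prod>i\<in>UNIV. emeasure std_normal (A i))"
    using A by (intro std_normals.emeasure_PiM) auto
  finally show ?thesis .
qed

text \<open>Dividing by \<open>c\<close> reduces the claim to W having independent standard normal
  coordinates, which is tested on boxes. A box event is an intersection of one event per time;
  independence over time factors it, and the law at each time factors it over the coordinates.
  Rescaling then restores the covariance.\<close>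

lemma (in prob_space) distr_lift_noise:
  fixes s0 :: "'a \<Rightarrow> real^'n" and \<epsilon> :: "nat \<Rightarrow> 'a \<Rightarrow> real^'m" and c :: "real^'m"
  assumes ind: "jointly_indep M s0 \<epsilon> {..<CARD('t)}" and c: "\<And>i. 0 < c $ i"
    and law: "\<And>t. t < CARD('t) \<Longrightarrow> distr M borel (\<epsilon> t) = mv_normal (diag (\<chi> i. (c $ i)\<^sup>2))"
  shows "distr M borel (\<lambda>\<omega>. lift_noise (\<lambda>t. \<epsilon> t \<omega>) :: real^('t::{finite,linorder} \<times> 'm))
    = mv_normal (diag (\<chi> p. (c $ snd p)\<^sup>2))"
proof -
  have c0: "c $ i \<noteq> 0" for i using c[of i] by simp
  have \<epsilon>_meas: "\<epsilon> (time t) \<in> borel_measurable M" for t :: 't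
    using ind time_less[of t] by (simp add: jointly_indep_def)
  define W where "W \<omega> p = \<epsilon> (time (fst p)) \<omega> $ snd p / c $ snd p" for \<omega> and p :: "'t \<times> 'm"
  have W_coord: "(\<lambda>\<omega>. W \<omega> p) \<in> measurable M std_normal" for p
    unfolding W_def using borel_measurable_vec_nth[OF \<epsilon>_meas] by simp
  have W: "W \<in> measurable M std_normals"
    by (rule measurable_PiM_single'[OF W_coord]) (simp add: space_PiM)
  have "distr M std_normals W = std_normals"
  proof (rule std_normals.PiM_eqI)
    fix A :: "'t \<times> 'm \<Rightarrow> real set" assume "\<And>p. p \<in> UNIV \<Longrightarrow> A p \<in> sets std_normal"
    then have A: "A p \<in> sets borel" for p by simp
    define B where "B t = {x :: real^'m. \<forall>j. x $ j / c $ j \<in> A (t, j)}" for t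
    have B: "B t \<in> sets borel" for t unfolding B_def by (intro sets_box A)
    \<comment> \<open>\<open>D\<close> is evaluated only at indices \<open>Some (time t)\<close>,
      where \<open>the\<close> and \<open>inv time\<close> recover the block
      \<open>t\<close>.\<close>
    define D where "D j = \<epsilon> (the j) -` B (inv time (the j)) \<inter> space M" for j
    have inj: "inj (time :: 't \<Rightarrow> nat)"
      using time_strict_mono by (rule strict_mono_imp_inj_on)
    have D_time: "D (Some (time t)) = \<epsilon> (time t) -` B t \<inter> space M" for t
      by (simp add: D_def inj)
    have box: "W -` Pi\<^sub>E UNIV A \<inter> space M = (\<Inter>j\<in>(\<lambda>t::'t. Some (time t)) ` UNIV. D j)"
      unfolding INT_simps image_image D_time by (auto simp: D_time W_def B_def PiE_iff)
    have "emeasure (distr M std_normals W) (Pi\<^sub>E UNIV A) = emeasure M (W -` Pi\<^sub>E UNIV A \<inter> space M)"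
      using A by (intro emeasure_distr W sets_PiM_I_finite) auto
    also have "\<dots> = ennreal (prob (\<Inter>j\<in>(\<lambda>t::'t. Some (time t)) ` UNIV. D j))"
      by (simp only: box emeasure_eq_measure)
    also have "prob (\<Inter>j\<in>(\<lambda>t::'t. Some (time t)) ` UNIV. D j) = (\<Prod>j\<in>(\<lambda>t::'t. Some (time t)) ` UNIV. prob (D j))"
    proof (rule indep_setsD)
      show "indep_sets (\<lambda>j. case j of None \<Rightarrow> {s0 -` Z \<inter> space M | Z. Z \<in> sets borel}
            | Some t \<Rightarrow> {\<epsilon> t -` Z \<inter> space M | Z. Z \<in> sets borel}) (insert None (Some ` {..<CARD('t)}))"
        using ind by (simp add: jointly_indep_def)
      show "\<forall>j\<in>(\<lambda>t::'t. Some (time t)) ` UNIV. D j \<in>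
          (case j of None \<Rightarrow> {s0 -` Z \<inter> space M | Z. Z \<in> sets borel}
            | Some t \<Rightarrow> {\<epsilon> t -` Z \<inter> space M | Z. Z \<in> sets borel})"
        using B by (auto simp: D_time)
    qed (auto simp: time_less)
    also have "\<dots> = (\<Prod>t\<in>UNIV. prob (\<epsilon> (time t) -` B t \<inter> space M))"
      using inj by (subst prod.reindex) (auto simp: D_time inj_on_def)
    also have "ennreal \<dots> = (\<Prod>t\<in>UNIV. emeasure M (\<epsilon> (time t) -` B t \<inter> space M))"
      by (simp only: emeasure_eq_measure prod_ennreal measure_nonneg)
    also have "\<dots> = (\<Prod>t\<in>UNIV. \<Prod>j\<in>UNIV. emeasure std_normal (A (t, j)))"
    proof (intro prod.cong refl)
      fix t :: 't
      have "emeasure M (\<epsilon> (time t) -` B t \<inter> space M) = emeasure (distr M borel (\<epsilon> (time t))) (B t)"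
        by (rule emeasure_distr[symmetric, OF \<epsilon>_meas B])
      also have "\<dots> = (\<Prod>j\<in>UNIV. emeasure std_normal (A (t, j)))"
        unfolding law[OF time_less] B_def using A by (intro emeasure_mv_normal_diag_box c) 
      finally show "emeasure M (\<epsilon> (time t) -` B t \<inter> space M) = (\<Prod>j\<in>UNIV. emeasure std_normal (A (t, j)))" .
    qed
    also have "\<dots> = (\<Prod>p\<in>UNIV. emeasure std_normal (A p))"
      by (simp add: prod.cartesian_product)
    finally show "emeasure (distr M std_normals W) (Pi\<^sub>E UNIV A) = (\<Prod>p\<in>UNIV. emeasure std_normal (A p))" .
  qed simp_all
  moreover have "(\<chi> p. c $ snd p * W \<omega> p) = lift_noise (\<lambda>t. \<epsilon> t \<omega>)" for \<omega>
    by (simp add: W_def lift_noise_def c0)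
  moreover have "(\<lambda>z. \<chi> p. c $ snd p * z p) \<in> borel_measurable (std_normals :: ('t \<times> 'm \<Rightarrow> real) measure)"
    by (subst borel_measurable_vec_iff) simp
  moreover have "mv_normal (diag (\<chi> p. (c $ snd p)\<^sup>2)) =
      distr std_normals borel (\<lambda>z :: 't \<times> 'm \<Rightarrow> real. \<chi> p. c $ snd p * z p)"
    using mv_normal_diag[of "\<chi> p :: 't \<times> 'm. c $ snd p"] c by simp
  ultimately show ?thesis
    using distr_distr[OF _ W, of "\<lambda>z. \<chi> p. c $ snd p * z p" borel] by (simp add: comp_def)
qed

section \<open>The lifted system\<close>

lemma sum_time: "(\<Sum>t\<in>(UNIV :: 't::{finite,linorder} set). f (time t)) = (\<Sum>i<CARD('t). f i)"
  by (rule sum.reindex_bij_betw[OF bij_betw_time])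

lemma sum_UNIV_prod: "(\<Sum>p\<in>UNIV. f p) = (\<Sum>x\<in>UNIV. \<Sum>y\<in>UNIV. f (x, y))"
  for f :: "'a::finite \<times> 'b::finite \<Rightarrow> real"
  by (simp add: sum.cartesian_product)

text \<open>The bound on \<open>t\<close> makes every \<open>i < t\<close> the time of some block,
  so after reindexing along \<open>time\<close> only the zero blocks at times from \<open>t\<close>
  on are dropped.\<close>

lemma E_blk_mult_lift_noise:
  assumes "t \<le> CARD('t)"
  shows "E_blk A B K t *v (lift_noise e :: real^('t::{finite,linorder} \<times> 'm::finite))
    = (\<Sum>i<t. mat_pow (A + B ** K) (t - 1 - i) *v (B *v e i))"
proof (subst vec_eq_iff, intro allI)
  fix k
  let ?G = "\<lambda>i. mat_pow (A + B ** K) (t - 1 - i) ** B"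
  have "(E_blk A B K t *v (lift_noise e :: real^('t \<times> 'm))) $ k
      = (\<Sum>\<tau>\<in>(UNIV :: 't set). \<Sum>j\<in>UNIV. (if time \<tau> < t then ?G (time \<tau>) $ k $ j else 0) * e (time \<tau>) $ j)"
    by (simp add: matrix_vector_mult_def E_blk_def lift_noise_def sum_UNIV_prod cong: if_cong)
  also have "\<dots> = (\<Sum>i<CARD('t). \<Sum>j\<in>UNIV. (if i < t then ?G i $ k $ j else 0) * e i $ j)"
    by (rule sum_time)
  also have "\<dots> = (\<Sum>i<t. \<Sum>j\<in>UNIV. (if i < t then ?G i $ k $ j else 0) * e i $ j)"
    using assms by (intro sum.mono_neutral_right) auto
  also have "\<dots> = (\<Sum>i<t. mat_pow (A + B ** K) (t - 1 - i) *v (B *v e i)) $ k"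
    by (simp add: matrix_vector_mul_assoc) (simp add: matrix_vector_mult_def)
  finally show "(E_blk A B K t *v (lift_noise e :: real^('t \<times> 'm))) $ k
      = (\<Sum>i<t. mat_pow (A + B ** K) (t - 1 - i) *v (B *v e i)) $ k" .
qed

lemma state_step:
  "state A B K s0 e (Suc t) = (A + B ** K) *v state A B K s0 e t + B *v e t"
  by (simp add: matrix_vector_right_distrib matrix_vector_mult_add_rdistrib matrix_vector_mul_assoc)

lemma state_eq_sum:
  "state A B K s0 e t = mat_pow (A + B ** K) t *v s0 + (\<Sum>i<t. mat_pow (A + B ** K) (t - 1 - i) *v (B *v e i))"
proof (induction t)
  case (Suc t)
  let ?F = "A + B ** K"
  have "(\<Sum>i<t. mat_pow ?F (Suc t - 1 - i) *v (B *v e i)) = (\<Sum>i<t. ?F *v (mat_pow ?F (t - 1 - i) *v (B *v e i)))"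
  proof (intro sum.cong refl)
    fix i assume "i \<in> {..<t}"
    \<comment> \<open>The subtraction is truncated, so this needs \<open>i < t\<close>. The
      remaining summand \<open>i = t\<close> has exponent 0 and supplies the newest noise
      term.\<close>
    then have "Suc t - 1 - i = Suc (t - 1 - i)" by simp
    then show "mat_pow ?F (Suc t - 1 - i) *v (B *v e i) = ?F *v (mat_pow ?F (t - 1 - i) *v (B *v e i))"
      by (simp only: mat_pow.simps matrix_vector_mul_assoc matrix_mul_assoc)
  qed
  also have "\<dots> = ?F *v (\<Sum>i<t. mat_pow ?F (t - 1 - i) *v (B *v e i))"
    by (simp add: linear_sum[OF matrix_vector_mul_linear])
  finally show ?case
    unfolding state_step Suc.IH
    by (simp add: matrix_vector_right_distrib matrix_vector_mul_assoc)
qed simp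

lemma state_lifted:
  assumes "t \<le> CARD('t)"
  shows "state A B K s0 e t
    = F_blk A B K t *v s0 + E_blk A B K t *v (lift_noise e :: real^('t::{finite,linorder} \<times> 'm::finite))"
  by (simp only: state_eq_sum F_blk_def E_blk_mult_lift_noise[OF assms])

lemma Pi_blk_mult_lift_noise:
  fixes t :: "'t::{finite,linorder}"
  shows "Pi_blk (time t) *v (lift_noise e :: real^('t \<times> 'm::finite)) = e (time t)"
proof (subst vec_eq_iff, intro allI)
  fix j
  have inj: "time x = time t \<longleftrightarrow> x = t" for x :: 't
    using strict_mono_eq[OF time_strict_mono] .
  have "(Pi_blk (time t) *v (lift_noise e :: real^('t \<times> 'm))) $ j
      = (\<Sum>p\<in>UNIV. if p = (t, j) then e (time t) $ j else 0)"
    unfolding matrix_vector_mult_def Pi_blk_def lift_noise_def vec_lambda_beta inj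
    by (intro sum.cong) auto
  then show "(Pi_blk (time t) *v (lift_noise e :: real^('t \<times> 'm))) $ j = e (time t) $ j"
    by simp
qed

lemma vstack_mult_vector: "vstack Z *v x = (\<chi> p. (Z (fst p) *v x) $ snd p)"
  by (simp add: vstack_def matrix_vector_mult_def vec_eq_iff)

text \<open>The Kronecker product is block diagonal in time. \<open>lift_noise\<close> stacks any
  sequence of vectors, and \<open>y\<close> will be the sequence of successor states or of
  actions.\<close>

lemma quad_discounted:
  fixes y :: "nat \<Rightarrow> real^'k"
  shows "(lift_noise y :: real^('t::{finite,linorder} \<times> 'k::finite)) \<bullet> (discounted \<gamma> Q *v lift_noise y)
    = (\<Sum>t<CARD('t). \<gamma> ^ t * (y t \<bullet> (Q *v y t)))"
proof -
  have "(discounted \<gamma> Q *v (lift_noise y :: real^('t \<times> 'k))) $ (t, i) = \<gamma> ^ time t * (Q *v y (time t)) $ i" for t i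
  proof -
    have "(discounted \<gamma> Q *v (lift_noise y :: real^('t \<times> 'k))) $ (t, i)
        = (\<Sum>u\<in>UNIV. \<Sum>j\<in>UNIV. (if t = u then \<gamma> ^ time t else 0) * Q $ i $ j * y (time u) $ j)"
      by (simp add: matrix_vector_mult_def discounted_def kron_def lift_noise_def sum_UNIV_prod cong: if_cong)
    also have "\<dots> = (\<Sum>u\<in>UNIV. if u = t then \<Sum>j\<in>UNIV. \<gamma> ^ time t * Q $ i $ j * y (time t) $ j else 0)"
      by (intro sum.cong) auto
    finally show ?thesis by (simp add: matrix_vector_mult_def sum_distrib_left mult.assoc)
  qed
  then have "(lift_noise y :: real^('t \<times> 'k)) \<bullet> (discounted \<gamma> Q *v lift_noise y)
      = (\<Sum>t\<in>UNIV. \<Sum>i\<in>UNIV. y (time (t::'t)) $ i * (\<gamma> ^ time t * (Q *v y (time t)) $ i))"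
    by (simp add: inner_vec_def sum_UNIV_prod lift_noise_def)
  also have "\<dots> = (\<Sum>t<CARD('t). \<Sum>i\<in>UNIV. y t $ i * (\<gamma> ^ t * (Q *v y t) $ i))"
    by (rule sum_time)
  finally show ?thesis
    by (simp add: inner_vec_def sum_distrib_left mult_ac)
qed

lemma norm_lift_noise:
  "(norm (lift_noise y :: real^('t::{finite,linorder} \<times> 'k::finite)))\<^sup>2 = (\<Sum>t<CARD('t). (norm (y t))\<^sup>2)"
proof -
  have "(norm (lift_noise y :: real^('t \<times> 'k)))\<^sup>2 = (\<Sum>t\<in>(UNIV :: 't set). (norm (y (time t)))\<^sup>2)"
    unfolding power2_norm_eq_inner by (simp add: inner_vec_def sum_UNIV_prod lift_noise_def)
  then show ?thesis
    using sum_time[of "\<lambda>i. (norm (y i))\<^sup>2", where 't='t] by simp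
qed

lemma inner_transpose_mult: "(P *v x) \<bullet> y = x \<bullet> (transpose P *v y)" for P :: "real^'a^'b"
  by (metis dot_lmul_matrix inner_commute transpose_matrix_vector)

lemma inner_sandwich: "(P *v x) \<bullet> (Q *v (R *v y)) = x \<bullet> ((transpose P ** Q ** R) *v y)"
  for P :: "real^'a^'b"
  by (simp only: inner_transpose_mult matrix_vector_mul_assoc matrix_mul_assoc)

lemma transpose_discounted:
  assumes "transpose Q = Q" shows "transpose (discounted \<gamma> Q) = discounted \<gamma> Q"
proof -
  have "Q $ i $ j = Q $ j $ i" for i j using assms by (metis transpose_def vec_lambda_beta)
  then show ?thesis by (auto simp: vec_eq_iff transpose_def discounted_def kron_def)
qed

text \<open>Symmetry of \<open>Q\<close> merges the two cross terms into one doubled term, the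
  origin of the 2 in front of the bilinear part of the return.\<close>

lemma quad_add:
  fixes Q :: "real^'a^'a"
  assumes "transpose Q = Q"
  shows "(P *v x + R *v y) \<bullet> (Q *v (P *v x + R *v y)) = x \<bullet> ((transpose P ** Q ** P) *v x)
     + 2 * (x \<bullet> ((transpose P ** Q ** R) *v y)) + y \<bullet> ((transpose R ** Q ** R) *v y)"
proof -
  have "(R *v y) \<bullet> (Q *v (P *v x)) = (P *v x) \<bullet> (Q *v (R *v y))"
    using inner_transpose_mult[of Q "R *v y" "P *v x"] assms by (simp add: inner_commute)
  then show ?thesis
    by (simp add: matrix_vector_right_distrib inner_add inner_sandwich)
qed

lemma traj_return_quadratic:
  fixes A :: "real^'n^'n" and B :: "real^'m^'n" and K :: "real^'n^'m" and e :: "nat \<Rightarrow> real^'m"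
  defines "FSp \<equiv> F_S_plus A B K" and "FEp \<equiv> F_E_plus A B K" and "KS \<equiv> K_S A B K" and "KE \<equiv> K_E A B K"
    and "eb \<equiv> (lift_noise e :: real^('t::{finite,linorder} \<times> 'm::finite))"
  assumes Qs: "transpose Qs = Qs" and Qa: "transpose Qa = Qa"
  shows "traj_return A B K Qs Qa \<gamma> CARD('t) s0 e = - (
      s0 \<bullet> ((transpose FSp ** discounted \<gamma> Qs ** FSp + transpose KS ** discounted \<gamma> Qa ** KS) *v s0)
      + 2 * (s0 \<bullet> ((transpose FSp ** discounted \<gamma> Qs ** FEp + transpose KS ** discounted \<gamma> Qa ** KE) *v eb))
      + eb \<bullet> ((transpose FEp ** discounted \<gamma> Qs ** FEp + transpose KE ** discounted \<gamma> Qa ** KE) *v eb))"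
proof -
  have y: "FSp *v s0 + FEp *v eb = (lift_noise (\<lambda>t. state A B K s0 e (Suc t)) :: real^('t \<times> 'n))"
  proof (subst vec_eq_iff, intro allI)
    fix p :: "'t \<times> 'n"
    \<comment> \<open>The reward at time t reads the state at t + 1, so the lifted formula is needed
      up to and including the horizon; actions stop one step earlier.\<close>
    have "Suc (time (fst p)) \<le> CARD('t)"
      by (simp only: Suc_le_eq time_less)
    from state_lifted[OF this, of A B K s0 e]
    show "(FSp *v s0 + FEp *v eb) $ p = (lift_noise (\<lambda>t. state A B K s0 e (Suc t)) :: real^('t \<times> 'n)) $ p"
      by (simp only: FSp_def FEp_def F_S_plus_def F_E_plus_def vstack_mult_vector eb_def lift_noise_def
          vec_lambda_beta vector_add_component)
  qed
  have u: "KS *v s0 + KE *v eb = (lift_noise (action A B K s0 e) :: real^('t \<times> 'm))"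
  proof (subst vec_eq_iff, intro allI)
    fix p :: "'t \<times> 'm"
    have "time (fst p) \<le> CARD('t)"
      by (rule less_imp_le[OF time_less])
    from state_lifted[OF this, of A B K s0 e]
    have "action A B K s0 e (time (fst p)) = (K ** F_blk A B K (time (fst p))) *v s0
        + (K ** E_blk A B K (time (fst p)) + Pi_blk (time (fst p))) *v eb"
      by (simp add: action_def matrix_vector_right_distrib matrix_vector_mult_add_rdistrib
          matrix_vector_mul_assoc Pi_blk_mult_lift_noise eb_def)
    then show "(KS *v s0 + KE *v eb) $ p = (lift_noise (action A B K s0 e) :: real^('t \<times> 'm)) $ p"
      by (simp only: KS_def KE_def K_S_def K_E_def vstack_mult_vector lift_noise_def
          vec_lambda_beta vector_add_component)
  qed
  have "traj_return A B K Qs Qa \<gamma> CARD('t) s0 e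
      = - ((\<Sum>t<CARD('t). \<gamma> ^ t * (state A B K s0 e (Suc t) \<bullet> (Qs *v state A B K s0 e (Suc t))))
          + (\<Sum>t<CARD('t). \<gamma> ^ t * (action A B K s0 e t \<bullet> (Qa *v action A B K s0 e t))))"
    unfolding traj_return_def reward_def
    by (simp add: algebra_simps sum.distrib sum_negf sum_subtractf del: state.simps)
  also have "\<dots> = - ((FSp *v s0 + FEp *v eb) \<bullet> (discounted \<gamma> Qs *v (FSp *v s0 + FEp *v eb))
      + (KS *v s0 + KE *v eb) \<bullet> (discounted \<gamma> Qa *v (KS *v s0 + KE *v eb)))"
    unfolding y u quad_discounted ..
  also have "\<dots> = - (
      s0 \<bullet> ((transpose FSp ** discounted \<gamma> Qs ** FSp + transpose KS ** discounted \<gamma> Qa ** KS) *v s0)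
      + 2 * (s0 \<bullet> ((transpose FSp ** discounted \<gamma> Qs ** FEp + transpose KS ** discounted \<gamma> Qa ** KE) *v eb))
      + eb \<bullet> ((transpose FEp ** discounted \<gamma> Qs ** FEp + transpose KE ** discounted \<gamma> Qa ** KE) *v eb))"
    unfolding quad_add[OF transpose_discounted[OF Qs]] quad_add[OF transpose_discounted[OF Qa]]
    by (simp add: matrix_vector_mult_add_rdistrib inner_add_right distrib_left)
  finally show ?thesis .
qed

lemma norm_stacked_states:
  fixes e :: "nat \<Rightarrow> real^'m" and s0 :: "real^'n"
  shows "(norm (F_S A B K *v s0 + F_E A B K *v (lift_noise e :: real^('t::{finite,linorder} \<times> 'm::finite))))\<^sup>2
    = (\<Sum>t<CARD('t). (norm (state A B K s0 e t))\<^sup>2)"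
proof -
  have "F_S A B K *v s0 + F_E A B K *v (lift_noise e :: real^('t \<times> 'm)) = lift_noise (state A B K s0 e)"
  proof (subst vec_eq_iff, intro allI)
    fix p :: "'t \<times> 'n"
    have "time (fst p) \<le> CARD('t)"
      by (rule less_imp_le[OF time_less])
    from state_lifted[OF this, of A B K s0 e]
    show "(F_S A B K *v s0 + F_E A B K *v (lift_noise e :: real^('t \<times> 'm))) $ p = lift_noise (state A B K s0 e) $ p"
      by (simp only: F_S_def F_E_def vstack_mult_vector lift_noise_def vec_lambda_beta vector_add_component)
  qed
  then show ?thesis by (simp only: norm_lift_noise)
qed

section \<open>Bounds on the gradient estimators\<close>

lemma norm_outer: "norm (outer x y) = norm x * norm y"
proof -
  have "(norm (outer x y))\<^sup>2 = (norm x * norm y)\<^sup>2"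
    unfolding power_mult_distrib power2_norm_eq_inner
    unfolding inner_vec_def inner_real_def sum_product by (simp add: outer_def mult_ac)
  then show ?thesis by (simp add: power2_eq_iff_nonneg)
qed

lemma matrix_mult_outer: "P ** outer x y = outer (P *v x) y"
  by (simp add: vec_eq_iff matrix_matrix_mult_def matrix_vector_mult_def outer_def sum_distrib_right mult.assoc)

lemma norm_add_squared_le: "(norm (x + y))\<^sup>2 \<le> 2 * (norm x)\<^sup>2 + 2 * (norm y)\<^sup>2" for x y :: "'a::real_normed_vector"
proof -
  have "(norm (x + y))\<^sup>2 \<le> (norm x + norm y)\<^sup>2" by (intro power_mono norm_triangle_ineq norm_ge_zero)
  also have "\<dots> \<le> 2 * (norm x)\<^sup>2 + 2 * (norm y)\<^sup>2"
    using sum_squares_bound[of "norm x" "norm y"] by (simp add: power2_sum)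
  finally show ?thesis .
qed

lemma norm_sum_outer_squared_le:
  fixes x :: "nat \<Rightarrow> real^'a" and y :: "nat \<Rightarrow> real^'b"
  shows "(norm (\<Sum>t<T. outer (x t) (y t)))\<^sup>2 \<le> (\<Sum>t<T. (norm (x t))\<^sup>2) * (\<Sum>t<T. (norm (y t))\<^sup>2)"
proof -
  have "norm (\<Sum>t<T. outer (x t) (y t)) \<le> (\<Sum>t<T. norm (x t) * norm (y t))"
    using norm_sum[of "\<lambda>t. outer (x t) (y t)" "{..<T}"] by (simp only: norm_outer)
  then have "(norm (\<Sum>t<T. outer (x t) (y t)))\<^sup>2 \<le> (\<Sum>t<T. norm (x t) * norm (y t))\<^sup>2"
    by (intro power_mono norm_ge_zero)
  also have "\<dots> \<le> (\<Sum>t<T. (norm (x t))\<^sup>2) * (\<Sum>t<T. (norm (y t))\<^sup>2)"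
    by (rule Cauchy_Schwarz_ineq_sum)
  finally show ?thesis .
qed

text \<open>The inverse covariance moves into the first vector of each outer product, and the states
  stack to a part from \<open>s0\<close> plus a part from the noise. Splitting the square of that
  sum costs the factor 2 and separates (star) from (dagger).\<close>

lemma norm_reinforce_K_squared_le:
  fixes e :: "nat \<Rightarrow> real^'m" and s0 :: "real^'n"
  shows "(norm (reinforce_K A B K Qs Qa \<gamma> Sig CARD('t) s0 e))\<^sup>2
    \<le> 2 * ((norm (lift_noise (\<lambda>t. matrix_inv Sig *v e t) :: real^('t::{finite,linorder} \<times> 'm)))\<^sup>2
            * (norm (F_S A B K *v s0 :: real^('t \<times> 'n)))\<^sup>2
            * (traj_return A B K Qs Qa \<gamma> CARD('t) s0 e)\<^sup>2)
     + 2 * ((norm (lift_noise (\<lambda>t. matrix_inv Sig *v e t) :: real^('t \<times> 'm)))\<^sup>2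
            * (norm (F_E A B K *v (lift_noise e :: real^('t \<times> 'm))))\<^sup>2
            * (traj_return A B K Qs Qa \<gamma> CARD('t) s0 e)\<^sup>2)"
proof -
  let ?R = "traj_return A B K Qs Qa \<gamma> CARD('t) s0 e"
  let ?x = "\<lambda>t. matrix_inv Sig *v e t"
  let ?N = "(norm (lift_noise ?x :: real^('t \<times> 'm)))\<^sup>2"
  let ?s = "F_S A B K *v s0 :: real^('t \<times> 'n)"
  let ?e = "F_E A B K *v (lift_noise e :: real^('t \<times> 'm))"
  have "reinforce_K A B K Qs Qa \<gamma> Sig CARD('t) s0 e = ?R *\<^sub>R (\<Sum>t<CARD('t). outer (?x t) (state A B K s0 e t))"
    by (simp only: reinforce_K_def matrix_mult_outer scaleR_sum_right)
  then have "(norm (reinforce_K A B K Qs Qa \<gamma> Sig CARD('t) s0 e))\<^sup>2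
      = ?R\<^sup>2 * (norm (\<Sum>t<CARD('t). outer (?x t) (state A B K s0 e t)))\<^sup>2"
    by (simp only: norm_scaleR power_mult_distrib power2_abs)
  also have "\<dots> \<le> ?R\<^sup>2 * (?N * (norm (?s + ?e))\<^sup>2)"
    unfolding norm_lift_noise norm_stacked_states
    by (intro mult_left_mono norm_sum_outer_squared_le zero_le_power2)
  also have "\<dots> \<le> ?R\<^sup>2 * (?N * (2 * (norm ?s)\<^sup>2 + 2 * (norm ?e)\<^sup>2))"
    by (intro mult_left_mono norm_add_squared_le zero_le_power2)
  also have "\<dots> = 2 * (?N * (norm ?s)\<^sup>2 * ?R\<^sup>2) + 2 * (?N * (norm ?e)\<^sup>2 * ?R\<^sup>2)"
    by (simp only: distrib_left mult_ac)
  finally show ?thesis .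
qed

lemma sum_power4_le: "(\<Sum>i\<in>I. (z i) ^ 4) \<le> (\<Sum>i\<in>I. (z i)\<^sup>2)\<^sup>2" for z :: "'i \<Rightarrow> real"
proof (induction I rule: infinite_finite_induct)
  case (insert i I)
  have "0 \<le> (z i)\<^sup>2 * (\<Sum>i\<in>I. (z i)\<^sup>2)" by (intro mult_nonneg_nonneg sum_nonneg zero_le_power2)
  moreover have "(z i) ^ 4 = ((z i)\<^sup>2)\<^sup>2" by (simp add: power_mult[symmetric])
  ultimately show ?case using insert by (simp add: power2_sum)
qed simp_all

text \<open>The constants 2 and 2 m T come from (z^2 - 1)^2 \<le> 2 z^4 + 2, summed over the m T
  whitened coordinates. The outer factor T is Cauchy--Schwarz against the constant sequence 1 of
  length T.\<close>

lemma norm_reinforce_l_squared_le: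
  fixes e :: "nat \<Rightarrow> real^'m" and s0 :: "real^'n" and c :: "real^'m"
  assumes c: "\<And>i. 0 < c $ i"
  shows "(norm (reinforce_l A B K Qs Qa \<gamma> (diag (\<chi> i. (c $ i)\<^sup>2)) CARD('t) s0 e))\<^sup>2
    \<le> real CARD('t) * ((2 * (norm (lift_noise (\<lambda>t. \<chi> i. e t $ i / c $ i) :: real^('t::{finite,linorder} \<times> 'm))) ^ 4
          + 2 * real CARD('m) * real CARD('t)) * (traj_return A B K Qs Qa \<gamma> CARD('t) s0 e)\<^sup>2)"
proof -
  let ?R = "traj_return A B K Qs Qa \<gamma> CARD('t) s0 e"
  let ?z = "lift_noise (\<lambda>t. \<chi> i. e t $ i / c $ i) :: real^('t \<times> 'm)"
  define g where "g t = matrix_inv (diag (\<chi> i. (c $ i)\<^sup>2)) *v (e t * e t) - 1" for t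
  have c0: "c $ i \<noteq> 0" for i using c[of i] by simp
  have g: "g t $ i = (e t $ i / c $ i)\<^sup>2 - 1" for t i
    unfolding g_def by (subst matrix_inv_diag) (simp_all add: c0 diag_mult_vector power_divide field_simps power2_eq_square)
  have sq: "(x\<^sup>2 - 1)\<^sup>2 \<le> 2 * x ^ 4 + 2" for x :: real
  proof -
    have "2 * x ^ 4 + 2 = (x\<^sup>2 - 1)\<^sup>2 + (x\<^sup>2 + 1)\<^sup>2"
      by (simp add: power2_eq_square power4_eq_xxxx algebra_simps)
    then show ?thesis using zero_le_power2[of "x\<^sup>2 + 1"] by linarith
  qed
  have "(\<Sum>t<CARD('t). (norm (g t))\<^sup>2) = (\<Sum>t<CARD('t). \<Sum>i\<in>UNIV. (g t $ i)\<^sup>2)"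
    by (simp only: power2_norm_eq_inner inner_vec_def inner_real_def power2_eq_square[of "_ $ _"])
  also have "\<dots> \<le> (\<Sum>t<CARD('t). \<Sum>i\<in>UNIV. 2 * (e t $ i / c $ i) ^ 4 + 2)"
    unfolding g by (intro sum_mono sq)
  also have "\<dots> = (\<Sum>t\<in>(UNIV :: 't set). \<Sum>i\<in>UNIV. 2 * (e (time t) $ i / c $ i) ^ 4 + 2)"
    by (rule sum_time[symmetric])
  also have "\<dots> = 2 * (\<Sum>p\<in>UNIV. (?z $ p) ^ 4) + 2 * real CARD('m) * real CARD('t)"
    by (simp add: sum_UNIV_prod lift_noise_def sum.distrib sum_distrib_left)
  also have "\<dots> \<le> 2 * (\<Sum>p\<in>UNIV. (?z $ p)\<^sup>2)\<^sup>2 + 2 * real CARD('m) * real CARD('t)"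
    using sum_power4_le[of "\<lambda>p. ?z $ p" UNIV] by simp
  also have "(\<Sum>p\<in>UNIV. (?z $ p)\<^sup>2)\<^sup>2 = (norm ?z) ^ 4"
  proof -
    have "(norm ?z) ^ 4 = ((norm ?z)\<^sup>2)\<^sup>2" by (simp only: power_mult[symmetric], simp)
    then show ?thesis
      by (simp only: power2_norm_eq_inner inner_vec_def inner_real_def power2_eq_square[of "_ $ _"])
  qed
  finally have bound: "(\<Sum>t<CARD('t). (norm (g t))\<^sup>2) \<le> 2 * (norm ?z) ^ 4 + 2 * real CARD('m) * real CARD('t)" .
  have "(norm (\<Sum>t<CARD('t). g t))\<^sup>2 \<le> (\<Sum>t<CARD('t). norm (g t))\<^sup>2"
    by (intro power_mono norm_sum norm_ge_zero)
  also have "\<dots> \<le> real CARD('t) * (\<Sum>t<CARD('t). (norm (g t))\<^sup>2)"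
    using Cauchy_Schwarz_ineq_sum[of "\<lambda>_. 1" "\<lambda>t. norm (g t)" "{..<CARD('t)}"] by simp
  also have "\<dots> \<le> real CARD('t) * (2 * (norm ?z) ^ 4 + 2 * real CARD('m) * real CARD('t))"
    by (intro mult_left_mono bound of_nat_0_le_iff)
  finally have "?R\<^sup>2 * (norm (\<Sum>t<CARD('t). g t))\<^sup>2
      \<le> ?R\<^sup>2 * (real CARD('t) * (2 * (norm ?z) ^ 4 + 2 * real CARD('m) * real CARD('t)))"
    by (intro mult_left_mono zero_le_power2)
  moreover have "reinforce_l A B K Qs Qa \<gamma> (diag (\<chi> i. (c $ i)\<^sup>2)) CARD('t) s0 e = ?R *\<^sub>R (\<Sum>t<CARD('t). g t)"
    by (simp only: reinforce_l_def g_def scaleR_sum_right)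
  ultimately show ?thesis
    by (simp only: norm_scaleR power_mult_distrib power2_abs mult_ac)
qed

section \<open>Weighted second moments of the return\<close>

lemma all_moments_mv_normal_measurable:
  "all_moments (mv_normal Q) f \<Longrightarrow> f \<in> borel_measurable borel"
  using all_moments_measurable[of "mv_normal Q" f] by (simp only: measurable_cong_sets[OF sets_mv_normal refl])

lemma matrix_vector_mult_uminus: "A *v (- x) = - (A *v x)" for A :: "real^'k^'r"
  by (simp add: matrix_vector_mult_def vec_eq_iff sum_negf)

lemma (in prob_space) all_moments_law:
  fixes X :: "'a \<Rightarrow> real^'k"
  assumes "X \<in> borel_measurable M" "distr M borel X = mv_normal Q" "all_moments (mv_normal Q) f"
  shows "all_moments M (\<lambda>\<omega>. f (X \<omega>))"
proof -
  have "f \<in> borel_measurable borel" using assms(3) by (rule all_moments_mv_normal_measurable)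
  then show ?thesis using assms all_moments_distr[of X M borel f] by simp
qed

text \<open>\<open>has_bochner_integral\<close> carries integrability and value together, so sums of
  such terms can be assembled by its addition and scaling rules. Independence is assumed for all
  real Borel functions of \<open>s\<close> and \<open>e\<close>, the form that
  \<open>indep_var_lift_noise\<close> provides.\<close>

lemma (in prob_space) has_bochner_integral_indep_product:
  fixes s :: "'a \<Rightarrow> real^'n" and e :: "'a \<Rightarrow> real^'k"
  assumes s: "s \<in> borel_measurable M" "distr M borel s = mv_normal Q"
    and e: "e \<in> borel_measurable M" "distr M borel e = mv_normal P"
    and ind: "\<And>f g. f \<in> borel_measurable borel \<Longrightarrow> g \<in> borel_measurable borel \<Longrightarrow>
        indep_var borel (\<lambda>\<omega>. f (s \<omega>) :: real) borel (\<lambda>\<omega>. g (e \<omega>) :: real)"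
    and f: "all_moments (mv_normal Q) f" and g: "all_moments (mv_normal P) g"
  shows "has_bochner_integral M (\<lambda>\<omega>. f (s \<omega>) * g (e \<omega>)) ((\<integral>x. f x \<partial>mv_normal Q) * (\<integral>x. g x \<partial>mv_normal P))"
proof -
  have fm: "f \<in> borel_measurable borel" and gm: "g \<in> borel_measurable borel"
    using f g by (simp_all add: all_moments_mv_normal_measurable)
  have i1: "integrable M (\<lambda>\<omega>. f (s \<omega>))" and i2: "integrable M (\<lambda>\<omega>. g (e \<omega>))"
    using all_moments_law[OF s f] all_moments_law[OF e g] by (simp_all add: all_moments_integrable)
  have "(\<integral>x. f x \<partial>mv_normal Q) = (\<integral>\<omega>. f (s \<omega>) \<partial>M)"
    unfolding s(2)[symmetric] by (rule integral_distr[OF s(1) fm])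
  moreover have "(\<integral>x. g x \<partial>mv_normal P) = (\<integral>\<omega>. g (e \<omega>) \<partial>M)"
    unfolding e(2)[symmetric] by (rule integral_distr[OF e(1) gm])
  ultimately show ?thesis
    using indep_var_lebesgue_integral[OF ind[OF fm gm] i1 i2] indep_var_integrable[OF ind[OF fm gm] i1 i2]
    by (simp add: has_bochner_integral_iff)
qed

lemma all_moments_mv_normal_linear: "all_moments (mv_normal Q) (\<lambda>x. (A *v x) $ i)"
  by (intro prob_space.all_moments_matrix_vector prob_space_mv_normal mv_normal_coordinate_moments)

lemma all_moments_mv_normal_quad: "all_moments (mv_normal Q) (\<lambda>x. x \<bullet> (A *v x))"
  by (intro prob_space.all_moments_quad prob_space_mv_normal mv_normal_coordinate_moments)

lemma quad_uminus: "(- x) \<bullet> (A *v (- x)) = x \<bullet> (A *v x)" for A :: "real^'k^'k"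
  by (simp add: matrix_vector_mult_uminus)

text \<open>This folds double sums over coordinates back into integrals of quadratic forms, which is
  how the b^2 terms return to \<open>IS\<close> notation.\<close>

lemma integral_weighted_quad:
  assumes w: "all_moments (mv_normal Q) w"
  shows "(\<integral>x. w x * (x \<bullet> (A *v x)) \<partial>mv_normal Q)
    = (\<Sum>i\<in>UNIV. \<Sum>j\<in>UNIV. A $ i $ j * (\<integral>x. w x * (x $ i * x $ j) \<partial>mv_normal Q))"
proof -
  have "(\<integral>x. w x * (x \<bullet> (A *v x)) \<partial>mv_normal Q)
      = (\<integral>x. (\<Sum>i\<in>UNIV. \<Sum>j\<in>UNIV. A $ i $ j * (w x * (x $ i * x $ j))) \<partial>mv_normal Q)"
    by (intro Bochner_Integration.integral_cong refl)
       (simp add: inner_vec_def matrix_vector_mult_def sum_distrib_left mult_ac)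
  also have "\<dots> = (\<Sum>i\<in>UNIV. \<Sum>j\<in>UNIV. A $ i $ j * (\<integral>x. w x * (x $ i * x $ j) \<partial>mv_normal Q))"
    unfolding integral_mult_right_zero[symmetric]
    by (subst Bochner_Integration.integral_sum, intro all_moments_integrable prob_space.all_moments_sum
         prob_space_mv_normal all_moments_mult prob_space.all_moments_const w mv_normal_coordinate_moments)
       (intro sum.cong refl Bochner_Integration.integral_sum all_moments_integrable prob_space_mv_normal
        all_moments_mult prob_space.all_moments_const w mv_normal_coordinate_moments)
  finally show ?thesis .
qed

text \<open>
  Expanding the square of the quadratic form gives products of a function of \<open>s\<close> and a function
  of \<open>e\<close>. The two cross terms with the bilinear part are odd in \<open>e\<close> and in \<open>s\<close> respectively.
\<close>

lemma (in prob_space) has_bochner_integral_weighted_return: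
  fixes s :: "'a \<Rightarrow> real^'n" and e :: "'a \<Rightarrow> real^'k"
  assumes s: "s \<in> borel_measurable M" "distr M borel s = mv_normal Q"
    and e: "e \<in> borel_measurable M" "distr M borel e = mv_normal P"
    and ind: "\<And>f g. f \<in> borel_measurable borel \<Longrightarrow> g \<in> borel_measurable borel \<Longrightarrow>
        indep_var borel (\<lambda>\<omega>. f (s \<omega>) :: real) borel (\<lambda>\<omega>. g (e \<omega>) :: real)"
    and v: "all_moments (mv_normal Q) v" "\<And>x. v (- x) = v x"
    and w: "all_moments (mv_normal P) w" "\<And>x. w (- x) = w x"
  shows "has_bochner_integral M
      (\<lambda>\<omega>. w (e \<omega>) * v (s \<omega>) * (- (s \<omega> \<bullet> (A *v s \<omega>) + 2 * (s \<omega> \<bullet> (B *v e \<omega>)) + e \<omega> \<bullet> (C *v e \<omega>)))\<^sup>2)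
      ((\<integral>x. v x * (x \<bullet> (A *v x))\<^sup>2 \<partial>mv_normal Q) * (\<integral>y. w y \<partial>mv_normal P)
       + (\<integral>x. v x \<partial>mv_normal Q) * (\<integral>y. w y * (y \<bullet> (C *v y))\<^sup>2 \<partial>mv_normal P)
       + 2 * ((\<integral>x. v x * (x \<bullet> (A *v x)) \<partial>mv_normal Q) * (\<integral>y. w y * (y \<bullet> (C *v y)) \<partial>mv_normal P))
       + 4 * (\<Sum>i\<in>UNIV. \<Sum>j\<in>UNIV. (\<integral>x. v x * (x $ i * x $ j) \<partial>mv_normal Q)
                * (\<integral>y. w y * ((B *v y) $ i * (B *v y) $ j) \<partial>mv_normal P)))"
    (is "has_bochner_integral M ?F ?I")
proof -
  note prod = has_bochner_integral_indep_product[OF s e ind]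
  note am = all_moments_mult prob_space.all_moments_power prob_space_mv_normal all_moments_mv_normal_quad
    all_moments_mv_normal_linear mv_normal_coordinate_moments v(1) w(1)
  let ?a = "\<lambda>x. x \<bullet> (A *v x)" and ?c = "\<lambda>y. y \<bullet> (C *v y)" and ?u = "\<lambda>y. B *v y"
  have odd_e: "(\<integral>y. w y * ?u y $ i \<partial>mv_normal P) = 0" for i
    by (rule integral_mv_normal_odd)
       (use all_moments_mv_normal_measurable[OF w(1)] in \<open>auto simp: w(2) matrix_vector_mult_uminus\<close>)
  have odd_s: "(\<integral>x. v x * x $ i \<partial>mv_normal Q) = 0" for i
    by (rule integral_mv_normal_odd)
       (use all_moments_mv_normal_measurable[OF v(1)] in \<open>auto simp: v(2)\<close>)
  have 1: "has_bochner_integral M (\<lambda>\<omega>. (v (s \<omega>) * (?a (s \<omega>))\<^sup>2) * w (e \<omega>))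
      ((\<integral>x. v x * (?a x)\<^sup>2 \<partial>mv_normal Q) * (\<integral>y. w y \<partial>mv_normal P))"
    by (rule prod) (assumption | intro am)+
  have 2: "has_bochner_integral M (\<lambda>\<omega>. v (s \<omega>) * (w (e \<omega>) * (?c (e \<omega>))\<^sup>2))
      ((\<integral>x. v x \<partial>mv_normal Q) * (\<integral>y. w y * (?c y)\<^sup>2 \<partial>mv_normal P))"
    by (rule prod) (assumption | intro am)+
  have 3: "has_bochner_integral M (\<lambda>\<omega>. 2 * ((v (s \<omega>) * ?a (s \<omega>)) * (w (e \<omega>) * ?c (e \<omega>))))
      (2 * ((\<integral>x. v x * ?a x \<partial>mv_normal Q) * (\<integral>y. w y * ?c y \<partial>mv_normal P)))"
    by (intro has_bochner_integral_mult_right, rule prod) (assumption | intro am)+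
  have 4: "has_bochner_integral M (\<lambda>\<omega>. 4 * (\<Sum>i\<in>UNIV. \<Sum>j\<in>UNIV. (v (s \<omega>) * (s \<omega> $ i * s \<omega> $ j)) * (w (e \<omega>) * (?u (e \<omega>) $ i * ?u (e \<omega>) $ j))))
      (4 * (\<Sum>i\<in>UNIV. \<Sum>j\<in>UNIV. (\<integral>x. v x * (x $ i * x $ j) \<partial>mv_normal Q)
                * (\<integral>y. w y * (?u y $ i * ?u y $ j) \<partial>mv_normal P)))"
    by (intro has_bochner_integral_mult_right has_bochner_integral_sum, rule prod) (assumption | intro am)+
  have 5: "has_bochner_integral M (\<lambda>\<omega>. 4 * (\<Sum>i\<in>UNIV. (v (s \<omega>) * (?a (s \<omega>) * s \<omega> $ i)) * (w (e \<omega>) * ?u (e \<omega>) $ i)))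
      (4 * (\<Sum>i\<in>UNIV. (\<integral>x. v x * (?a x * x $ i) \<partial>mv_normal Q) * (\<integral>y. w y * ?u y $ i \<partial>mv_normal P)))"
    by (intro has_bochner_integral_mult_right has_bochner_integral_sum, rule prod) (assumption | intro am)+
  have 6: "has_bochner_integral M (\<lambda>\<omega>. 4 * (\<Sum>i\<in>UNIV. (v (s \<omega>) * s \<omega> $ i) * (w (e \<omega>) * (?c (e \<omega>) * ?u (e \<omega>) $ i))))
      (4 * (\<Sum>i\<in>UNIV. (\<integral>x. v x * x $ i \<partial>mv_normal Q) * (\<integral>y. w y * (?c y * ?u y $ i) \<partial>mv_normal P)))"
    by (intro has_bochner_integral_mult_right has_bochner_integral_sum, rule prod) (assumption | intro am)+
  have bilin: "x \<bullet> (B *v y) = (\<Sum>i\<in>UNIV. x $ i * ?u y $ i)" for x y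
    by (simp add: inner_vec_def)
  have bb: "v' * w' * ((x \<bullet> (B *v y)) * (x \<bullet> (B *v y)))
      = (\<Sum>i\<in>UNIV. \<Sum>j\<in>UNIV. (v' * (x $ i * x $ j)) * (w' * (?u y $ i * ?u y $ j)))"
    and ab: "v' * a * w' * (x \<bullet> (B *v y)) = (\<Sum>i\<in>UNIV. (v' * (a * x $ i)) * (w' * ?u y $ i))"
    and cb: "w' * a * ((x \<bullet> (B *v y)) * v') = (\<Sum>i\<in>UNIV. (v' * x $ i) * (w' * (a * ?u y $ i)))"
    for v' w' a x y
    unfolding bilin sum_product by (simp_all add: sum_distrib_left mult_ac)
  \<comment> \<open>The factors of each summand stand in the order of the left-hand sides of
    \<open>bb\<close>, \<open>ab\<close> and \<open>cb\<close>, so that these match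
    literally.\<close>
  have expand: "w' * v' * (- (a + 2 * b + c))\<^sup>2
      = (v' * a\<^sup>2) * w' + v' * (w' * c\<^sup>2) + 2 * ((v' * a) * (w' * c)) + 4 * (v' * w' * (b * b))
        + 4 * (v' * a * w' * b) + 4 * (w' * c * (b * v'))" for w' v' a b c :: real
    by (simp add: power2_eq_square algebra_simps)
  have "?F = (\<lambda>\<omega>. (v (s \<omega>) * (?a (s \<omega>))\<^sup>2) * w (e \<omega>) + v (s \<omega>) * (w (e \<omega>) * (?c (e \<omega>))\<^sup>2)
      + 2 * ((v (s \<omega>) * ?a (s \<omega>)) * (w (e \<omega>) * ?c (e \<omega>)))
      + 4 * (\<Sum>i\<in>UNIV. \<Sum>j\<in>UNIV. (v (s \<omega>) * (s \<omega> $ i * s \<omega> $ j)) * (w (e \<omega>) * (?u (e \<omega>) $ i * ?u (e \<omega>) $ j)))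
      + 4 * (\<Sum>i\<in>UNIV. (v (s \<omega>) * (?a (s \<omega>) * s \<omega> $ i)) * (w (e \<omega>) * ?u (e \<omega>) $ i))
      + 4 * (\<Sum>i\<in>UNIV. (v (s \<omega>) * s \<omega> $ i) * (w (e \<omega>) * (?c (e \<omega>) * ?u (e \<omega>) $ i))))"
    by (simp only: expand bb[symmetric] ab[symmetric] cb[symmetric])
  with has_bochner_integral_add[OF has_bochner_integral_add[OF has_bochner_integral_add[OF
      has_bochner_integral_add[OF has_bochner_integral_add[OF 1 2] 3] 4] 5] 6]
  show ?thesis by (simp only: odd_e odd_s mult_zero_left mult_zero_right sum.neutral_const add_0_right)
qed

section \<open>Moments of the states, the return and the estimators\<close>

lemma (in prob_space) all_moments_vec_add:
  assumes "\<And>i. all_moments M (\<lambda>\<omega>. f \<omega> $ i)" "\<And>i. all_moments M (\<lambda>\<omega>. g \<omega> $ i)"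
  shows "all_moments M (\<lambda>\<omega>. (f \<omega> + g \<omega>) $ i)"
  unfolding vector_add_component by (intro all_moments_add assms)

text \<open>The state at time t involves only the noise before t, so t = T is allowed although the
  noise is controlled only at times below T.\<close>

lemma (in prob_space) all_moments_state:
  fixes s :: "'a \<Rightarrow> real^'n" and e :: "nat \<Rightarrow> 'a \<Rightarrow> real^'m"
  assumes s: "\<And>i. all_moments M (\<lambda>\<omega>. s \<omega> $ i)"
    and e: "\<And>t i. t < T \<Longrightarrow> all_moments M (\<lambda>\<omega>. e t \<omega> $ i)"
  shows "t \<le> T \<Longrightarrow> all_moments M (\<lambda>\<omega>. state A B K (s \<omega>) (\<lambda>t. e t \<omega>) t $ i)"
proof (induction t arbitrary: i)
  case 0
  then show ?case by (simp only: state.simps s)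
next
  case (Suc t)
  then show ?case
    unfolding state_step
    by (intro all_moments_vec_add all_moments_matrix_vector Suc.IH e) simp_all
qed

lemma (in prob_space) all_moments_traj_return:
  fixes s :: "'a \<Rightarrow> real^'n" and e :: "nat \<Rightarrow> 'a \<Rightarrow> real^'m"
  assumes s: "\<And>i. all_moments M (\<lambda>\<omega>. s \<omega> $ i)"
    and e: "\<And>t i. t < T \<Longrightarrow> all_moments M (\<lambda>\<omega>. e t \<omega> $ i)"
  shows "all_moments M (\<lambda>\<omega>. traj_return A B K Qs Qa \<gamma> T (s \<omega>) (\<lambda>t. e t \<omega>))"
  unfolding traj_return_def reward_def action_def
  by (intro all_moments_sum all_moments_mult all_moments_const all_moments_uminus all_moments_add
      all_moments_quad all_moments_vec_add all_moments_matrix_vector all_moments_state[OF s e] e)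
     (auto simp: Suc_le_eq)

lemma (in prob_space) all_moments_reinforce_K:
  fixes s :: "'a \<Rightarrow> real^'n" and e :: "nat \<Rightarrow> 'a \<Rightarrow> real^'m"
  assumes s: "\<And>i. all_moments M (\<lambda>\<omega>. s \<omega> $ i)"
    and e: "\<And>t i. t < T \<Longrightarrow> all_moments M (\<lambda>\<omega>. e t \<omega> $ i)"
    and b: "b \<in> Basis"
  shows "all_moments M (\<lambda>\<omega>. reinforce_K A B K Qs Qa \<gamma> Sig T (s \<omega>) (\<lambda>t. e t \<omega>) \<bullet> b)"
proof -
  obtain i j where b: "b = axis i (axis j 1)"
    using b by (auto simp: Basis_vec_def)
  have "reinforce_K A B K Qs Qa \<gamma> Sig T (s \<omega>) (\<lambda>t. e t \<omega>) \<bullet> b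
      = (\<Sum>t<T. traj_return A B K Qs Qa \<gamma> T (s \<omega>) (\<lambda>t. e t \<omega>)
          * ((matrix_inv Sig *v e t \<omega>) $ i * state A B K (s \<omega>) (\<lambda>t. e t \<omega>) t $ j))" for \<omega>
    unfolding reinforce_K_def matrix_mult_outer by (simp add: b inner_axis outer_def)
  then show ?thesis
    by (simp only:)
       (intro all_moments_sum all_moments_mult all_moments_traj_return all_moments_matrix_vector
          all_moments_state[OF s e] s e, auto)
qed

lemma (in prob_space) all_moments_reinforce_l:
  fixes s :: "'a \<Rightarrow> real^'n" and e :: "nat \<Rightarrow> 'a \<Rightarrow> real^'m"
  assumes s: "\<And>i. all_moments M (\<lambda>\<omega>. s \<omega> $ i)"
    and e: "\<And>t i. t < T \<Longrightarrow> all_moments M (\<lambda>\<omega>. e t \<omega> $ i)"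
    and b: "b \<in> Basis"
  shows "all_moments M (\<lambda>\<omega>. reinforce_l A B K Qs Qa \<gamma> Sig T (s \<omega>) (\<lambda>t. e t \<omega>) \<bullet> b)"
proof -
  obtain i where b: "b = axis i 1"
    using b by (auto simp: Basis_vec_def)
  have sq: "all_moments M (\<lambda>\<omega>. (e t \<omega> * e t \<omega>) $ i)" if "t < T" for t i
    unfolding vector_mult_component by (intro all_moments_mult e that)
  have "reinforce_l A B K Qs Qa \<gamma> Sig T (s \<omega>) (\<lambda>t. e t \<omega>) \<bullet> b
      = (\<Sum>t<T. traj_return A B K Qs Qa \<gamma> T (s \<omega>) (\<lambda>t. e t \<omega>)
          * ((matrix_inv Sig *v (e t \<omega> * e t \<omega>)) $ i - 1))" for \<omega>
    by (simp add: b inner_axis reinforce_l_def)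
  then show ?thesis
    by (simp only:)
       (intro all_moments_sum all_moments_mult all_moments_traj_return all_moments_diff all_moments_const
          all_moments_matrix_vector sq s e, simp_all)
qed

section \<open>Matrix identities behind the quadratic forms in \<open>S\<close>, \<open>E\<close>,
  \<open>U\<close>, \<open>V\<close> and \<open>X\<close>\<close>

lemma norm_mult_vector_squared: "(norm (P *v x))\<^sup>2 = x \<bullet> ((transpose P ** P) *v x)" for P :: "real^'a^'b"
  by (simp only: power2_norm_eq_inner inner_transpose_mult matrix_vector_mul_assoc)

lemma gram_nth: "(P ** transpose P) $ i $ j = (\<Sum>p\<in>UNIV. P $ i $ p * P $ j $ p)"
  by (simp add: matrix_matrix_mult_def transpose_def)

lemma diag_sandwich_nth: "(P ** diag v ** transpose P) $ i $ j = (\<Sum>p\<in>UNIV. P $ i $ p * P $ j $ p * v $ p)"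
proof -
  have "(P ** diag v) $ i $ p = P $ i $ p * v $ p" for p
    by (simp add: matrix_matrix_mult_def if_distrib[of "\<lambda>c. _ * c"] cong: if_cong)
  then show ?thesis
    by (simp add: matrix_matrix_mult_def[of "P ** diag v"] transpose_def mult_ac)
qed

lemma inner_outer_mult: "x \<bullet> (outer s s *v x) = (s \<bullet> x)\<^sup>2"
proof -
  have "outer s s *v x = (s \<bullet> x) *\<^sub>R s"
    by (simp add: vec_eq_iff outer_def matrix_vector_mult_def inner_vec_def sum_distrib_left mult_ac)
  then show ?thesis by (simp add: power2_eq_square inner_commute)
qed

text \<open>The quadratic form of \<open>transpose B ** outer s s ** B\<close> at y is the square of
  \<open>s \<bullet> (B *v y)\<close>. Its weighted mean is therefore a quadratic form in
  \<open>s\<close>, whose matrix consists of the weighted second moments of \<open>B *v y\<close>;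
  this explains the shape of \<open>X\<close>.\<close>

lemma integral_weighted_outer_sandwich:
  assumes w: "all_moments (mv_normal Q) w"
  shows "(\<integral>y. w y * (y \<bullet> ((transpose B ** outer s s ** B) *v y)) \<partial>mv_normal Q)
    = s \<bullet> ((\<chi> i j. \<integral>y. w y * ((B *v y) $ i * (B *v y) $ j) \<partial>mv_normal Q) *v s)"
proof -
  note am = all_moments_mult prob_space.all_moments_const prob_space.all_moments_sum prob_space_mv_normal
    all_moments_mv_normal_linear w
  have sq: "(\<Sum>i\<in>UNIV. s $ i * u $ i)\<^sup>2 = (\<Sum>i\<in>UNIV. \<Sum>j\<in>UNIV. (s $ i * s $ j) * (u $ i * u $ j))" for u
    unfolding power2_eq_square sum_product by (simp add: mult_ac)
  have "(\<integral>y. w y * (y \<bullet> ((transpose B ** outer s s ** B) *v y)) \<partial>mv_normal Q)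
      = (\<integral>y. (\<Sum>i\<in>UNIV. \<Sum>j\<in>UNIV. (s $ i * s $ j) * (w y * ((B *v y) $ i * (B *v y) $ j))) \<partial>mv_normal Q)"
    unfolding inner_sandwich[symmetric] inner_outer_mult
    by (intro Bochner_Integration.integral_cong refl)
       (simp add: inner_vec_def sq sum_distrib_left mult.left_commute)
  also have "\<dots> = (\<Sum>i\<in>UNIV. \<Sum>j\<in>UNIV. (s $ i * s $ j) * (\<integral>y. w y * ((B *v y) $ i * (B *v y) $ j) \<partial>mv_normal Q))"
    unfolding integral_mult_right_zero[symmetric]
    by (subst Bochner_Integration.integral_sum, intro all_moments_integrable am)
       (intro sum.cong refl Bochner_Integration.integral_sum all_moments_integrable am)
  also have "\<dots> = s \<bullet> ((\<chi> i j. \<integral>y. w y * ((B *v y) $ i * (B *v y) $ j) \<partial>mv_normal Q) *v s)"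
    by (simp add: inner_vec_def matrix_vector_mult_def sum_distrib_left mult_ac)
  finally show ?thesis .
qed

lemma lift_noise_diag: "diag (\<chi> p. v $ snd p) *v lift_noise e = lift_noise (\<lambda>t. diag v *v e t)"
  by (simp add: diag_mult_vector lift_noise_def)

theorem theorem8:
  fixes M :: "'w measure"
    and s0 :: "'w \<Rightarrow> real^'n"
    and \<epsilon> :: "nat \<Rightarrow> 'w \<Rightarrow> real^'m"
    and A Qs Sig0 Mss S U V :: "real^'n^'n"
    and B :: "real^'m^'n"
    and K :: "real^'n^'m"
    and Qa Sig :: "real^'m^'m"
    and l :: "real^'m"
    and \<gamma> star dagger ell d :: real
    and m T :: nat
    and G_K :: "'w \<Rightarrow> real^'n^'m"
    and G_l :: "'w \<Rightarrow> real^'m"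
    and R :: "'w \<Rightarrow> real"
    and \<epsilon>b :: "'w \<Rightarrow> real^('t::{finite,linorder} \<times> 'm)"
    and FS FSp :: "real^'n^('t \<times> 'n)"
    and FE FEp :: "real^('t \<times> 'm)^('t \<times> 'n)"
    and KS :: "real^'n^('t \<times> 'm)"
    and KE Qag Sigb Mee E :: "real^('t \<times> 'm)^('t \<times> 'm)"
    and Qsg :: "real^('t \<times> 'n)^('t \<times> 'n)"
    and Mse :: "real^('t \<times> 'm)^'n"
    and X :: "real^'n \<Rightarrow> real^('t \<times> 'm)^('t \<times> 'm)"
  assumes m: "m = CARD('m)" and T: "T = CARD('t)"
    and Qs: "psd Qs" and Qa: "psd Qa" and Sig0: "psd Sig0"
    and \<gamma>: "0 < \<gamma>" "\<gamma> \<le> 1"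
    and Sig: "Sig = diag (\<chi> i. exp (2 * l $ i))"
    and M: "prob_space M"
    and s0: "distr M borel s0 = mv_normal Sig0"
    and \<epsilon>: "\<And>t. t < T \<Longrightarrow> distr M borel (\<epsilon> t) = mv_normal Sig"
    and indep: "jointly_indep M s0 \<epsilon> {..<T}"
    and R: "R = (\<lambda>\<omega>. traj_return A B K Qs Qa \<gamma> T (s0 \<omega>) (\<lambda>t. \<epsilon> t \<omega>))"
    and G_K: "G_K = (\<lambda>\<omega>. reinforce_K A B K Qs Qa \<gamma> Sig T (s0 \<omega>) (\<lambda>t. \<epsilon> t \<omega>))"
    and G_l: "G_l = (\<lambda>\<omega>. reinforce_l A B K Qs Qa \<gamma> Sig T (s0 \<omega>) (\<lambda>t. \<epsilon> t \<omega>))"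
    and \<epsilon>b: "\<epsilon>b = (\<lambda>\<omega>. lift_noise (\<lambda>t. \<epsilon> t \<omega>))"
    and Sigb: "Sigb = kron (mat 1) Sig"
    and FS: "FS = F_S A B K" and FE: "FE = F_E A B K"
    and FSp: "FSp = F_S_plus A B K" and FEp: "FEp = F_E_plus A B K"
    and KS: "KS = K_S A B K" and KE: "KE = K_E A B K"
    and Qsg: "Qsg = discounted \<gamma> Qs" and Qag: "Qag = discounted \<gamma> Qa"
    and Mss: "Mss = transpose FSp ** Qsg ** FSp + transpose KS ** Qag ** KS"
    and Mse: "Mse = transpose FSp ** Qsg ** FEp + transpose KS ** Qag ** KE"
    and Mee: "Mee = transpose FEp ** Qsg ** FEp + transpose KE ** Qag ** KE"
    and S: "S = transpose FS ** FS"
    and E: "E = transpose FE ** FE"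
    and U: "U = Mse ** transpose Mse"
    and V: "V = Mse ** Sigb ** transpose Mse"
    and X: "X = (\<lambda>s. transpose Mse ** outer s s ** Mse)"
    and d: "d = real (m * T)"
    and star: "star =
      (\<integral>\<omega>. (norm (matrix_inv Sigb *v \<epsilon>b \<omega>))\<^sup>2 * (norm (FS *v s0 \<omega>))\<^sup>2 * (R \<omega>)\<^sup>2 \<partial>M)"
    and dagger: "dagger =
      (\<integral>\<omega>. (norm (matrix_inv Sigb *v \<epsilon>b \<omega>))\<^sup>2 * (norm (FE *v \<epsilon>b \<omega>))\<^sup>2 * (R \<omega>)\<^sup>2 \<partial>M)"
    and ell: "ell =
      real T * (\<integral>\<omega>. (2 * (norm (matrix_inv (psd_sqrt Sigb) *v \<epsilon>b \<omega>)) ^ 4 + 2 * real m * real T)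
                        * (R \<omega>)\<^sup>2 \<partial>M)"
  shows "Var_Fro M G_K \<le> 2 * star + 2 * dagger
    \<and> Var_Fro M G_l \<le> ell
    \<and> star =
        IS Sigb [matrix_inv Sigb ** matrix_inv Sigb] * IS Sig0 [S, Mss, Mss]
        + IS Sig0 [S] * IS Sigb [matrix_inv Sigb ** matrix_inv Sigb, Mee, Mee]
        + 2 * IS Sig0 [S, Mss] * IS Sigb [matrix_inv Sigb ** matrix_inv Sigb, Mee]
        + 4 * (IS Sigb [matrix_inv Sigb ** matrix_inv Sigb] * IS Sig0 [S, V] + 2 * IS Sig0 [S, U])
    \<and> dagger =
        IS Sigb [matrix_inv Sigb ** matrix_inv Sigb, E] * IS Sig0 [Mss, Mss]
        + IS Sigb [matrix_inv Sigb ** matrix_inv Sigb, E, Mee, Mee]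
        + 2 * IS Sig0 [Mss] * IS Sigb [matrix_inv Sigb ** matrix_inv Sigb, E, Mee]
        + 4 * (\<integral>s. IS Sigb [matrix_inv Sigb ** matrix_inv Sigb, E, X s] \<partial>mv_normal Sig0)
    \<and> ell =
        real T *
          (2 * (IS Sig0 [Mss, Mss] * IS Sigb [matrix_inv Sigb, matrix_inv Sigb]
                + IS Sigb [matrix_inv Sigb, matrix_inv Sigb, Mee, Mee]
                + 2 * IS Sig0 [Mss] * IS Sigb [matrix_inv Sigb, matrix_inv Sigb, Mee]
                + 4 * (d + 2) * (d + 4) * IS Sig0 [V])
           + 2 * real m * real T *
               (IS Sig0 [Mss, Mss] + IS Sigb [Mee, Mee]
                + 2 * IS Sig0 [Mss] * IS Sigb [Mee] + 4 * IS Sig0 [V]))"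
proof -
  interpret prob_space M by (rule M)
  let ?q = "\<lambda>A x. x \<bullet> (A *v x)"
  let ?N0 = "mv_normal Sig0" and ?Nb = "mv_normal Sigb"

  \<comment> \<open>The entries of \<open>c\<close> are the standard deviations: exp(2 l) is the
    square of exp(l). All lemmas on diagonal covariances are phrased in terms of such a positive
    root.\<close>
  define c :: "real^'m" where "c = (\<chi> i. exp (l $ i))"
  define cb :: "real^('t \<times> 'm)" where "cb = (\<chi> p. c $ snd p)"
  have c: "0 < c $ i" for i by (simp add: c_def)
  have cb: "0 < cb $ p" for p by (simp add: cb_def c)
  have cb0: "cb $ p \<noteq> 0" for p using cb[of p] by simp
  have Sig_c: "Sig = diag (\<chi> i. (c $ i)\<^sup>2)"
    by (simp add: Sig c_def exp_double)
  have Sigb_c: "Sigb = diag (\<chi> p. (cb $ p)\<^sup>2)"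
    by (simp add: Sigb Sig_c kron_mat_1_diag cb_def)
  have Sigb_inv: "matrix_inv Sigb = diag (\<chi> p. inverse ((cb $ p)\<^sup>2))"
    unfolding Sigb_c by (subst matrix_inv_diag) (simp_all add: cb0)
  have sqrt_inv: "matrix_inv (psd_sqrt Sigb) = diag (\<chi> p. inverse (cb $ p))"
    unfolding Sigb_c psd_sqrt_diag[OF cb] by (rule matrix_inv_diag[OF cb0])

  have indep_T: "jointly_indep M s0 \<epsilon> {..<CARD('t)}" using indep by (simp add: T)
  have s0_meas: "s0 \<in> borel_measurable M" and \<epsilon>_meas: "\<And>t. t < T \<Longrightarrow> \<epsilon> t \<in> borel_measurable M"
    using indep by (auto simp: jointly_indep_def)
  have \<epsilon>b_meas: "\<epsilon>b \<in> borel_measurable M"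
    unfolding borel_measurable_vec_iff \<epsilon>b lift_noise_def vec_lambda_beta
    using time_less by (intro allI borel_measurable_vec_nth \<epsilon>_meas) (simp add: T)
  have law: "distr M borel \<epsilon>b = ?Nb"
    unfolding \<epsilon>b Sigb_c cb_def vec_lambda_beta
    by (rule distr_lift_noise[OF indep_T c]) (use \<epsilon> in \<open>simp add: T Sig_c\<close>)
  have ind: "indep_var borel (\<lambda>\<omega>. f (s0 \<omega>)) borel (\<lambda>\<omega>. g (\<epsilon>b \<omega>))"
    if "f \<in> borel_measurable borel" "g \<in> borel_measurable borel"
    for f :: "real^'n \<Rightarrow> real" and g :: "real^('t \<times> 'm) \<Rightarrow> real"
    unfolding \<epsilon>b using indep_T that by (rule indep_var_lift_noise)
  have s0_mom: "all_moments M (\<lambda>\<omega>. s0 \<omega> $ i)" for i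
    by (rule all_moments_law[OF s0_meas s0 mv_normal_coordinate_moments])
  have \<epsilon>_mom: "all_moments M (\<lambda>\<omega>. \<epsilon> t \<omega> $ i)" if "t < T" for t i
    by (rule all_moments_law[OF \<epsilon>_meas[OF that] \<epsilon>[OF that] mv_normal_coordinate_moments])
  have R_quad: "R \<omega> = - (s0 \<omega> \<bullet> (Mss *v s0 \<omega>) + 2 * (s0 \<omega> \<bullet> (Mse *v \<epsilon>b \<omega>)) + \<epsilon>b \<omega> \<bullet> (Mee *v \<epsilon>b \<omega>))" for \<omega>
    using Qs Qa unfolding R T Mss Mse Mee FSp FEp KS KE Qsg Qag \<epsilon>b psd_def
    by (intro traj_return_quadratic) simp_all
  have expansion: "has_bochner_integral M (\<lambda>\<omega>. w (\<epsilon>b \<omega>) * v (s0 \<omega>) * (R \<omega>)\<^sup>2)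
      ((\<integral>x. v x * (?q Mss x)\<^sup>2 \<partial>?N0) * (\<integral>y. w y \<partial>?Nb) + (\<integral>x. v x \<partial>?N0) * (\<integral>y. w y * (?q Mee y)\<^sup>2 \<partial>?Nb)
       + 2 * ((\<integral>x. v x * ?q Mss x \<partial>?N0) * (\<integral>y. w y * ?q Mee y \<partial>?Nb))
       + 4 * (\<Sum>i\<in>UNIV. \<Sum>j\<in>UNIV. (\<integral>x. v x * (x $ i * x $ j) \<partial>?N0)
                * (\<integral>y. w y * ((Mse *v y) $ i * (Mse *v y) $ j) \<partial>?Nb)))"
    if "all_moments ?N0 v" "\<And>x. v (- x) = v x" "all_moments ?Nb w" "\<And>y. w (- y) = w y" for v w
    unfolding R_quad
    by (rule has_bochner_integral_weighted_return[OF s0_meas s0 \<epsilon>b_meas law _ that]) (rule ind)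
  note am = all_moments_mult prob_space.all_moments_power prob_space.all_moments_const prob_space_mv_normal
    all_moments_mv_normal_quad

  have IS: "IS Q [A1] = (\<integral>x. ?q A1 x \<partial>mv_normal Q)"
    "IS Q [A1, A2] = (\<integral>x. ?q A1 x * ?q A2 x \<partial>mv_normal Q)"
    "IS Q [A1, A2, A3] = (\<integral>x. ?q A1 x * (?q A2 x * ?q A3 x) \<partial>mv_normal Q)"
    "IS Q [A1, A2, A3, A4] = (\<integral>x. ?q A1 x * (?q A2 x * (?q A3 x * ?q A4 x)) \<partial>mv_normal Q)"
    for Q A1 A2 A3 A4 :: "real^'k^'k"
    by (simp_all add: IS_def)

  define W where "W = matrix_inv Sigb ** matrix_inv Sigb"
  have W_diag: "W = diag (\<chi> p. inverse ((cb $ p)\<^sup>2) * inverse ((cb $ p)\<^sup>2))"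
    by (simp add: W_def Sigb_inv diag_mult_diag)
  have W_norm: "(norm (matrix_inv Sigb *v y))\<^sup>2 = ?q W y" for y
    unfolding norm_mult_vector_squared W_def by (simp add: Sigb_inv transpose_diag)
  have U_nth: "U $ i $ j = (\<Sum>p\<in>UNIV. Mse $ i $ p * Mse $ j $ p)" for i j
    by (simp add: U gram_nth)
  have V_nth: "V $ i $ j = (\<Sum>p\<in>UNIV. Mse $ i $ p * Mse $ j $ p * (cb $ p)\<^sup>2)" for i j
    by (simp add: V Sigb_c diag_sandwich_nth)
  \<comment> \<open>Weighted noise moments of the form k \<open>Sigb\<close> + h I become k
    \<open>V\<close> + h \<open>U\<close> under \<open>Mse\<close>. Each weight below only has to
    supply its k and h.\<close>
  have linear_pair: "(\<integral>y. w y * ((Mse *v y) $ i * (Mse *v y) $ j) \<partial>?Nb) = k * V $ i $ j + h * U $ i $ j"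
    if "all_moments ?Nb w"
      and "\<And>p q. (\<integral>y. w y * (y $ p * y $ q) \<partial>?Nb) = (if p = q then k * (cb $ p)\<^sup>2 + h else 0)"
    for w k h i j
    unfolding prob_space.integral_weighted_linear_pair[OF prob_space_mv_normal that(1) mv_normal_coordinate_moments that(2)]
      U_nth V_nth by (simp add: distrib_left sum.distrib sum_distrib_left mult_ac)
  have combine: "(\<Sum>i\<in>UNIV. \<Sum>j\<in>UNIV. (\<integral>x. v x * (x $ i * x $ j) \<partial>?N0) * (k * V $ i $ j + h * U $ i $ j))
      = k * (\<integral>x. v x * ?q V x \<partial>?N0) + h * (\<integral>x. v x * ?q U x \<partial>?N0)"
    if "all_moments ?N0 v" for v k h
    unfolding integral_weighted_quad[OF that]
    by (simp add: sum_distrib_left sum.distrib[symmetric] algebra_simps)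

  \<comment> \<open>The three moment expansions\<close>
  have star_I: "has_bochner_integral M
      (\<lambda>\<omega>. (norm (matrix_inv Sigb *v \<epsilon>b \<omega>))\<^sup>2 * (norm (FS *v s0 \<omega>))\<^sup>2 * (R \<omega>)\<^sup>2)
      (IS Sigb [W] * IS Sig0 [S, Mss, Mss] + IS Sig0 [S] * IS Sigb [W, Mee, Mee]
        + 2 * IS Sig0 [S, Mss] * IS Sigb [W, Mee]
        + 4 * (IS Sigb [W] * IS Sig0 [S, V] + 2 * IS Sig0 [S, U]))"
  proof -
    have quad: "IS Sigb [W] = (\<Sum>r\<in>UNIV. inverse ((cb $ r)\<^sup>2) * inverse ((cb $ r)\<^sup>2) * (cb $ r)\<^sup>2)"
      unfolding IS W_diag Sigb_c integral_mv_normal_diag_quad[OF cb] by simp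
    have "(\<integral>y. ?q W y * (y $ p * y $ q) \<partial>?Nb) = (if p = q then IS Sigb [W] * (cb $ p)\<^sup>2 + 2 else 0)" for p q
    proof -
      \<comment> \<open>The entries of \<open>W\<close> are \<open>cb\<close> to the power -4, which
        cancels the covariance factors on both sides. This is h = 2 in \<open>linear_pair\<close>,
        while k is the trace \<open>IS Sigb [W]\<close>.\<close>
      have "(cb $ p)\<^sup>2 * (2 * (inverse ((cb $ p)\<^sup>2) * inverse ((cb $ p)\<^sup>2) * (cb $ p)\<^sup>2)) = 2"
        by (simp add: cb0)
      then show ?thesis
        unfolding quad unfolding W_diag Sigb_c integral_mv_normal_diag_quad_pair[OF cb]
        by (simp only: vec_lambda_beta distrib_left mult.commute)
    qed
    from linear_pair[OF all_moments_mv_normal_quad this]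
    have pair: "(\<integral>y. ?q W y * ((Mse *v y) $ i * (Mse *v y) $ j) \<partial>?Nb)
        = IS Sigb [W] * V $ i $ j + 2 * U $ i $ j" for i j .
    have FS_norm: "(norm (FS *v x))\<^sup>2 = ?q S x" for x
      by (simp only: norm_mult_vector_squared S)
    from expansion[OF all_moments_mv_normal_quad quad_uminus all_moments_mv_normal_quad quad_uminus, of W S]
    show ?thesis
      unfolding pair combine[OF all_moments_mv_normal_quad] W_norm FS_norm
      by (simp only: IS power2_eq_square mult.commute mult.left_commute mult.assoc)
  qed

  have dagger_I: "has_bochner_integral M
      (\<lambda>\<omega>. (norm (matrix_inv Sigb *v \<epsilon>b \<omega>))\<^sup>2 * (norm (FE *v \<epsilon>b \<omega>))\<^sup>2 * (R \<omega>)\<^sup>2)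
      (IS Sigb [W, E] * IS Sig0 [Mss, Mss] + IS Sigb [W, E, Mee, Mee]
        + 2 * IS Sig0 [Mss] * IS Sigb [W, E, Mee]
        + 4 * (\<integral>s. IS Sigb [W, E, X s] \<partial>mv_normal Sig0))"
  proof -
    define w where "w y = ?q W y * ?q E y" for y
    have w: "all_moments ?Nb w" unfolding w_def by (intro am)
    \<comment> \<open>Since \<open>E\<close> need not be diagonal, the weighted moments of
      \<open>Mse *v y\<close> stay unevaluated in \<open>?G\<close>. Averaging the quadratic form of
      \<open>?G\<close> over \<open>s0\<close> is exactly the double sum of the expansion with
      weight 1 on \<open>s0\<close>.\<close>
    let ?G = "\<chi> i j. \<integral>y. w y * ((Mse *v y) $ i * (Mse *v y) $ j) \<partial>?Nb"
    have one: "all_moments ?N0 (\<lambda>_. 1)" by (intro am)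
    have "IS Sigb [W, E, X s] = ?q ?G s" for s
      using integral_weighted_outer_sandwich[OF w, of Mse s] unfolding IS X w_def by (simp only: mult.assoc)
    then have "(\<integral>s. IS Sigb [W, E, X s] \<partial>?N0) = (\<integral>s. 1 * ?q ?G s \<partial>?N0)"
      by (simp only: mult_1_left)
    also have "\<dots> = (\<Sum>i\<in>UNIV. \<Sum>j\<in>UNIV. (\<integral>x. 1 * (x $ i * x $ j) \<partial>?N0)
        * (\<integral>y. w y * ((Mse *v y) $ i * (Mse *v y) $ j) \<partial>?Nb))"
      unfolding integral_weighted_quad[OF one] by (simp only: vec_lambda_beta mult.commute)
    finally have last: "(\<Sum>i\<in>UNIV. \<Sum>j\<in>UNIV. (\<integral>x. 1 * (x $ i * x $ j) \<partial>?N0)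
        * (\<integral>y. w y * ((Mse *v y) $ i * (Mse *v y) $ j) \<partial>?Nb)) = (\<integral>s. IS Sigb [W, E, X s] \<partial>?N0)" ..
    have FE_norm: "(norm (FE *v y))\<^sup>2 = ?q E y" for y
      by (simp only: norm_mult_vector_squared E)
    have "w (- y) = w y" for y by (simp only: w_def quad_uminus)
    from expansion[OF one refl w this] show ?thesis
      unfolding last W_norm FE_norm
      using prob_space.prob_space[OF prob_space_mv_normal, of Sig0]
      by (simp add: IS w_def power2_eq_square mult_ac)
  qed

  have ell_I: "has_bochner_integral M
      (\<lambda>\<omega>. (2 * (norm (matrix_inv (psd_sqrt Sigb) *v \<epsilon>b \<omega>)) ^ 4 + 2 * real m * real T) * (R \<omega>)\<^sup>2)
      (2 * (IS Sig0 [Mss, Mss] * IS Sigb [matrix_inv Sigb, matrix_inv Sigb]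
                + IS Sigb [matrix_inv Sigb, matrix_inv Sigb, Mee, Mee]
                + 2 * IS Sig0 [Mss] * IS Sigb [matrix_inv Sigb, matrix_inv Sigb, Mee]
                + 4 * (d + 2) * (d + 4) * IS Sig0 [V])
           + 2 * real m * real T *
               (IS Sig0 [Mss, Mss] + IS Sigb [Mee, Mee]
                + 2 * IS Sig0 [Mss] * IS Sigb [Mee] + 4 * IS Sig0 [V]))"
  proof -
    have mass: "measure (mv_normal Q) UNIV = 1" for Q :: "real^'k^'k"
      using prob_space.prob_space[OF prob_space_mv_normal, of Q] by simp
    have one: "all_moments (mv_normal Q) (\<lambda>_. 1)" for Q :: "real^'k^'k" by (intro am)
    have w: "all_moments ?Nb (\<lambda>y. (?q (matrix_inv Sigb) y)\<^sup>2)" by (intro am)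
    have dim: "real CARD('t \<times> 'm) = d" by (simp add: d m T)
    \<comment> \<open>Here k = (d + 2)(d + 4) and h = 0, so no term in \<open>U\<close> arises; the
      constant weight below has k = 1 and h = 0.\<close>
    have "(\<integral>y. (?q (matrix_inv Sigb) y)\<^sup>2 * (y $ p * y $ q) \<partial>?Nb)
        = (if p = q then (d + 2) * (d + 4) * (cb $ p)\<^sup>2 + 0 else 0)" for p q
      unfolding Sigb_inv unfolding Sigb_c integral_mv_normal_diag_whitened[OF cb] dim by simp
    from linear_pair[OF w this]
    have pair4: "(\<integral>y. (?q (matrix_inv Sigb) y)\<^sup>2 * ((Mse *v y) $ i * (Mse *v y) $ j) \<partial>?Nb)
        = (d + 2) * (d + 4) * V $ i $ j + 0 * U $ i $ j" for i j .
    have "(\<integral>y. 1 * (y $ p * y $ q) \<partial>?Nb) = (if p = q then 1 * (cb $ p)\<^sup>2 + 0 else 0)" for p q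
      unfolding Sigb_c mult_1_left integral_mv_normal_diag_pair[OF cb] by simp
    from linear_pair[OF one this]
    have pair0: "(\<integral>y. 1 * ((Mse *v y) $ i * (Mse *v y) $ j) \<partial>?Nb) = 1 * V $ i $ j + 0 * U $ i $ j" for i j .
    have q4: "(norm (matrix_inv (psd_sqrt Sigb) *v y)) ^ 4 = (?q (matrix_inv Sigb) y)\<^sup>2" for y
    proof -
      have "(norm (matrix_inv (psd_sqrt Sigb) *v y))\<^sup>2 = ?q (matrix_inv Sigb) y"
        unfolding norm_mult_vector_squared sqrt_inv
        by (simp add: transpose_diag diag_mult_diag Sigb_inv power2_eq_square)
      then have "((norm (matrix_inv (psd_sqrt Sigb) *v y))\<^sup>2)\<^sup>2 = (?q (matrix_inv Sigb) y)\<^sup>2" by (rule arg_cong)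
      then show ?thesis by (simp only: power_mult[symmetric]) simp
    qed
    have e2: "(?q (matrix_inv Sigb) (- y))\<^sup>2 = (?q (matrix_inv Sigb) y)\<^sup>2" for y by (simp only: quad_uminus)
    \<comment> \<open>The weight of the integrand is a sum of two: \<open>first\<close> treats the
      fourth power of the whitened norm, \<open>second\<close> the constant, and they are recombined
      with coefficients 2 and 2 m T.\<close>
    note first = expansion[OF one refl w e2, unfolded pair4 combine[OF one]]
    note second = expansion[OF one refl one refl, unfolded pair0 combine[OF one]]
    have "(\<lambda>\<omega>. (2 * (norm (matrix_inv (psd_sqrt Sigb) *v \<epsilon>b \<omega>)) ^ 4 + 2 * real m * real T) * (R \<omega>)\<^sup>2)
        = (\<lambda>\<omega>. 2 * ((?q (matrix_inv Sigb) (\<epsilon>b \<omega>))\<^sup>2 * 1 * (R \<omega>)\<^sup>2) + (2 * real m * real T) * (1 * 1 * (R \<omega>)\<^sup>2))"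
      by (simp only: q4 distrib_right mult_1_left mult_1_right mult.assoc)
    with has_bochner_integral_add[OF has_bochner_integral_mult_right[OF first, of 2]
        has_bochner_integral_mult_right[OF second, of "2 * real m * real T"]]
    show ?thesis
      by (simp add: IS power2_eq_square mass algebra_simps)
  qed

  have star_val: "star = IS Sigb [W] * IS Sig0 [S, Mss, Mss] + IS Sig0 [S] * IS Sigb [W, Mee, Mee]
        + 2 * IS Sig0 [S, Mss] * IS Sigb [W, Mee]
        + 4 * (IS Sigb [W] * IS Sig0 [S, V] + 2 * IS Sig0 [S, U])"
    unfolding star by (rule has_bochner_integral_integral_eq[OF star_I])
  have dagger_val: "dagger = IS Sigb [W, E] * IS Sig0 [Mss, Mss] + IS Sigb [W, E, Mee, Mee]
        + 2 * IS Sig0 [Mss] * IS Sigb [W, E, Mee]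
        + 4 * (\<integral>s. IS Sigb [W, E, X s] \<partial>mv_normal Sig0)"
    unfolding dagger by (rule has_bochner_integral_integral_eq[OF dagger_I])

  \<comment> \<open>The two variance bounds\<close>
  have noise: "matrix_inv Sigb *v \<epsilon>b \<omega> = lift_noise (\<lambda>t. matrix_inv Sig *v \<epsilon> t \<omega>)" for \<omega>
  proof -
    have "matrix_inv Sig = diag (\<chi> i. inverse ((c $ i)\<^sup>2))"
      unfolding Sig_c using c by (subst matrix_inv_diag) (simp_all add: less_imp_neq[symmetric])
    then show ?thesis
      using lift_noise_diag[of "\<chi> i. inverse ((c $ i)\<^sup>2)" "\<lambda>t. \<epsilon> t \<omega>"] by (simp add: Sigb_inv cb_def \<epsilon>b)
  qed
  have var_K: "Var_Fro M G_K \<le> 2 * star + 2 * dagger"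
  proof -
    let ?f = "\<lambda>\<omega>. (norm (matrix_inv Sigb *v \<epsilon>b \<omega>))\<^sup>2 * (norm (FS *v s0 \<omega>))\<^sup>2 * (R \<omega>)\<^sup>2"
    let ?g = "\<lambda>\<omega>. (norm (matrix_inv Sigb *v \<epsilon>b \<omega>))\<^sup>2 * (norm (FE *v \<epsilon>b \<omega>))\<^sup>2 * (R \<omega>)\<^sup>2"
    have mom: "all_moments M (\<lambda>\<omega>. G_K \<omega> \<bullet> b)" if "b \<in> Basis" for b
      unfolding G_K by (intro all_moments_reinforce_K s0_mom \<epsilon>_mom that)
    \<comment> \<open>The expansions also give the integrability of the upper bound, which
      \<open>integral_mono\<close> requires.\<close>
    have fg: "has_bochner_integral M (\<lambda>\<omega>. 2 * ?f \<omega> + 2 * ?g \<omega>) (2 * star + 2 * dagger)"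
      unfolding star_val dagger_val
      by (intro has_bochner_integral_add has_bochner_integral_mult_right star_I dagger_I)
    have "Var_Fro M G_K \<le> (\<integral>\<omega>. (norm (G_K \<omega>))\<^sup>2 \<partial>M)"
      by (rule Var_Fro_le_second_moment(1)[OF mom])
    also have "\<dots> \<le> (\<integral>\<omega>. 2 * ?f \<omega> + 2 * ?g \<omega> \<partial>M)"
    proof (rule integral_mono)
      show "integrable M (\<lambda>\<omega>. (norm (G_K \<omega>))\<^sup>2)"
        by (rule Var_Fro_le_second_moment(2)[OF mom])
      show "integrable M (\<lambda>\<omega>. 2 * ?f \<omega> + 2 * ?g \<omega>)"
        using fg by (rule integrable.intros)
      show "(norm (G_K \<omega>))\<^sup>2 \<le> 2 * ?f \<omega> + 2 * ?g \<omega>" for \<omega>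
        unfolding noise unfolding G_K R FS FE T \<epsilon>b by (rule norm_reinforce_K_squared_le)
    qed
    also have "\<dots> = 2 * star + 2 * dagger"
      using fg by (rule has_bochner_integral_integral_eq)
    finally show ?thesis .
  qed

  have whitened: "matrix_inv (psd_sqrt Sigb) *v \<epsilon>b \<omega> = lift_noise (\<lambda>t. \<chi> i. \<epsilon> t \<omega> $ i / c $ i)" for \<omega>
    by (simp add: sqrt_inv diag_mult_vector cb_def \<epsilon>b lift_noise_def divide_inverse mult.commute)
  have var_l: "Var_Fro M G_l \<le> ell"
  proof -
    let ?f = "\<lambda>\<omega>. (2 * (norm (matrix_inv (psd_sqrt Sigb) *v \<epsilon>b \<omega>)) ^ 4 + 2 * real m * real T) * (R \<omega>)\<^sup>2"
    have mom: "all_moments M (\<lambda>\<omega>. G_l \<omega> \<bullet> b)" if "b \<in> Basis" for b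
      unfolding G_l by (intro all_moments_reinforce_l s0_mom \<epsilon>_mom that)
    have "Var_Fro M G_l \<le> (\<integral>\<omega>. (norm (G_l \<omega>))\<^sup>2 \<partial>M)"
      by (rule Var_Fro_le_second_moment(1)[OF mom])
    also have "\<dots> \<le> (\<integral>\<omega>. real T * ?f \<omega> \<partial>M)"
    proof (rule integral_mono)
      show "integrable M (\<lambda>\<omega>. (norm (G_l \<omega>))\<^sup>2)"
        by (rule Var_Fro_le_second_moment(2)[OF mom])
      show "integrable M (\<lambda>\<omega>. real T * ?f \<omega>)"
        by (intro integrable_mult_right integrable.intros[OF ell_I])
      show "(norm (G_l \<omega>))\<^sup>2 \<le> real T * ?f \<omega>" for \<omega>
        unfolding whitened unfolding G_l R T m Sig_c by (rule norm_reinforce_l_squared_le[OF c])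
    qed
    also have "\<dots> = ell"
      unfolding ell by (rule integral_mult_right_zero)
    finally show ?thesis .
  qed
  have "ell = real T *
          (2 * (IS Sig0 [Mss, Mss] * IS Sigb [matrix_inv Sigb, matrix_inv Sigb]
                + IS Sigb [matrix_inv Sigb, matrix_inv Sigb, Mee, Mee]
                + 2 * IS Sig0 [Mss] * IS Sigb [matrix_inv Sigb, matrix_inv Sigb, Mee]
                + 4 * (d + 2) * (d + 4) * IS Sig0 [V])
           + 2 * real m * real T *
               (IS Sig0 [Mss, Mss] + IS Sigb [Mee, Mee]
                + 2 * IS Sig0 [Mss] * IS Sigb [Mee] + 4 * IS Sig0 [V]))"
    unfolding ell has_bochner_integral_integral_eq[OF ell_I] ..
  then show ?thesis
    using var_K var_l star_val[unfolded W_def] dagger_val[unfolded W_def] by (intro conjI)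
qed

end
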